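(* Assume at least one agent satisfies (M), every agent satisfying (M) is of type P or type E, at least one agent is of type E, and for all $\chi(0)\in\Delta_{A-1}^o$ and $i,j\in[A]$ the statements $\liminf_{N\to\infty}F_i(\chi_i(0)N)/F_j(\chi_j(0)N)=0$ and $\limsup_{N\to\infty}F_i(\chi_i(0)N)/F_j(\chi_j(0)N)=\infty$ do not hold simultaneously. If agent $i$ is of type E and $\chi(0)$ lies in the interior of $D_i$, then $\lim_{N\to\infty}\mathbb{P}(tMon_i(\chi(0),N))=1$.
   Context: Fix $A\ge 2$, $[A]=\{1,\dots,A\}$, and feedback functions $F_i:\mathbb{N}\to(0,\infty)$. The generalized Pólya urn is the Markov chain $X(n)\in\mathbb{N}^A$, $n\in\mathbb{N}_0$, with $X_i(0)\ge1$ and $\mathbb{P}(X(n+1)=X(n)+e^{(i)}\mid X(n))=F_i(X_i(n))/\sum_{j}F_j(X_j(n))$. $N=\sum_iX_i(0)$; $\Delta_{A-1}^o$ is the interior of the simplex $\{x\in[0,1]^A:\sum x_i=1\}$. For fixed $\chi(0)$ the process starts from $X_i(0)=\chi_i(0)N$ (rounded), and each $F_i$ is extended to a $C^1$ function on $(0,\infty)$ monotone on every $[n,n+1]$. $tMon_i(\chi(0),N)=\{\forall n\ge0\ \forall j\ne i:X_j(n)=X_j(0)\}$, $sMon_i(\chi(0),N)=\{\lim_n\sum_{j\ne i}X_j(n)<\infty\}$, and $D_i=\{\chi(0)\in\Delta_{A-1}^o:\lim_{N\to\infty}\mathbb{P}(sMon_i(\chi(0),N))=1\}$. Condition (M): $\sum_{k\ge1}1/F_i(k)<\infty$.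 Type P: (M) and $\lim_kF_i(k)\sum_{l\ge k}1/F_i(l)=\infty$. Type E: (M) and $\limsup_kF_i(k)\sum_{l\ge k}1/F_i(l)<\infty$. *)

theory Defs
  imports "HOL-Probability.Probability"
begin

text \<open>Agents are indexed by [A] = {1..A}; feedback functions are F :: nat => real => real,
  F i being the (C^1) extension of the i-th feedback function to (0,oo).
  Vectors in R^A are functions nat => real that vanish outside {1..A}.\<close>

definition agents :: "nat \<Rightarrow> nat set" where
  "agents A = {1..A}"

definition open_simplex :: "nat \<Rightarrow> (nat \<Rightarrow> real) set" where
  "open_simplex A = {x. (\<forall>i\<in>agents A. 0 < x i) \<and> (\<forall>i. i \<notin> agents A \<longrightarrow> x i = 0)
                        \<and> (\<Sum>i\<in>agents A. x i) = 1}"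

definition admissible_feedback :: "nat \<Rightarrow> (nat \<Rightarrow> real \<Rightarrow> real) \<Rightarrow> bool" where
  "admissible_feedback A F \<longleftrightarrow>
     (\<forall>i\<in>agents A. (\<forall>x>0. 0 < F i x) \<and> F i C1_differentiable_on {0<..} \<and>
        (\<forall>n::nat. mono_on ({real n..real n + 1} \<inter> {0<..}) (F i) \<or>
                  monotone_on ({real n..real n + 1} \<inter> {0<..}) (\<le>) (\<ge>) (F i)))"

definition cond_M :: "(nat \<Rightarrow> real \<Rightarrow> real) \<Rightarrow> nat \<Rightarrow> bool" where
  "cond_M F i \<longleftrightarrow> summable (\<lambda>k. 1 / F i (real (Suc k)))"

definition tail_sum :: "(nat \<Rightarrow> real \<Rightarrow> real) \<Rightarrow> nat \<Rightarrow> nat \<Rightarrow> real" where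
  "tail_sum F i k = (\<Sum>l. 1 / F i (real (l + k)))"

definition type_P :: "(nat \<Rightarrow> real \<Rightarrow> real) \<Rightarrow> nat \<Rightarrow> bool" where
  "type_P F i \<longleftrightarrow> cond_M F i \<and> filterlim (\<lambda>k. F i (real k) * tail_sum F i k) at_top sequentially"

definition type_E :: "(nat \<Rightarrow> real \<Rightarrow> real) \<Rightarrow> nat \<Rightarrow> bool" where
  "type_E F i \<longleftrightarrow> cond_M F i \<and>
     limsup (\<lambda>k. ereal (F i (real k) * tail_sum F i k)) < \<infinity>"

text \<open>Realisation of the urn on the probability space of an i.i.d. sequence of
  uniform [0,1] random variables: at step n, the colour drawn is the least j in [A] with
  U_n * total < F_1(X_1) + ... + F_j(X_j) (colour A on the null event U_n = 1).\<close>

definition unif_seq :: "(nat \<Rightarrow> real) measure" where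
  "unif_seq = (\<Pi>\<^sub>M n\<in>(UNIV::nat set). uniform_measure lborel {0..1::real})"

definition urn_pick :: "nat \<Rightarrow> (nat \<Rightarrow> real \<Rightarrow> real) \<Rightarrow> (nat \<Rightarrow> nat) \<Rightarrow> real \<Rightarrow> nat" where
  "urn_pick A F x u =
     (let tot = (\<Sum>j\<in>agents A. F j (real (x j))) in
      if \<exists>i\<in>agents A. u * tot < (\<Sum>j\<in>{1..i}. F j (real (x j)))
      then (LEAST i. i \<in> agents A \<and> u * tot < (\<Sum>j\<in>{1..i}. F j (real (x j))))
      else A)"

fun urn :: "nat \<Rightarrow> (nat \<Rightarrow> real \<Rightarrow> real) \<Rightarrow> (nat \<Rightarrow> nat) \<Rightarrow> (nat \<Rightarrow> real) \<Rightarrow> nat \<Rightarrow> nat \<Rightarrow> nat" where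
  "urn A F x0 \<omega> 0 = x0"
| "urn A F x0 \<omega> (Suc n) =
     (let x = urn A F x0 \<omega> n; c = urn_pick A F x (\<omega> n) in x(c := Suc (x c)))"

definition init_config :: "(nat \<Rightarrow> real) \<Rightarrow> nat \<Rightarrow> nat \<Rightarrow> nat" where
  "init_config chi N = (\<lambda>i. nat \<lceil>chi i * real N\<rceil>)"

definition tMon :: "nat \<Rightarrow> (nat \<Rightarrow> real \<Rightarrow> real) \<Rightarrow> nat \<Rightarrow> (nat \<Rightarrow> real) \<Rightarrow> nat \<Rightarrow> (nat \<Rightarrow> real) set" where
  "tMon A F i chi N = {\<omega> \<in> space unif_seq.
     \<forall>n. \<forall>j\<in>agents A. j \<noteq> i \<longrightarrow> urn A F (init_config chi N) \<omega> n j = init_config chi N j}"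

definition sMon :: "nat \<Rightarrow> (nat \<Rightarrow> real \<Rightarrow> real) \<Rightarrow> nat \<Rightarrow> (nat \<Rightarrow> real) \<Rightarrow> nat \<Rightarrow> (nat \<Rightarrow> real) set" where
  "sMon A F i chi N = {\<omega> \<in> space unif_seq.
     convergent (\<lambda>n. real (\<Sum>j\<in>agents A - {i}. urn A F (init_config chi N) \<omega> n j))}"

definition D_set :: "nat \<Rightarrow> (nat \<Rightarrow> real \<Rightarrow> real) \<Rightarrow> nat \<Rightarrow> (nat \<Rightarrow> real) set" where
  "D_set A F i = {chi \<in> open_simplex A.
     (\<lambda>N. measure unif_seq (sMon A F i chi N)) \<longlonglongrightarrow> 1}"

end

theory Submission
  imports Defs
begin

text \<open>Let \<open>g\<close> be the tail sum of \<open>1 / F\<^sub>i\<close>. Type E makes \<open>g\<close> decay geometrically and \<open>F\<^sub>i\<close> comparable to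
  \<open>1 / g\<close>. A union bound over the steps gives \<open>1 - P(tMon\<^sub>i) \<le> g(x\<^sub>i) \<Sum>\<^bsub>j\<noteq>i\<^esub> F\<^sub>j(x\<^sub>j)\<close>, so it suffices that
  \<open>F\<^sub>j(\<chi>\<^sub>j N) / F\<^sub>i(\<chi>\<^sub>i N) \<longrightarrow> 0\<close> for all \<open>j \<noteq> i\<close>.

  Suppose this fails for some \<open>j\<close>, and move mass \<open>t\<close> from \<open>i\<close> to \<open>j\<close>. This lowers the slope \<open>\<chi>\<^sub>i / \<chi>\<^sub>j\<close>, so \<open>F\<^sub>j(k)\<close>
  infinitely often exceeds \<open>F\<^sub>i(s k)\<close> by an unbounded factor for each lower slope \<open>s\<close>. If \<open>F\<^sub>j(k)\<close> were also infinitely often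
  below \<open>1 / g(s k)\<close> for some lower \<open>s\<close>, a Baire category argument would produce a point of the simplex at which the ratio has
  lower limit \<open>0\<close> and upper limit \<open>\<infinity>\<close>, which is excluded. Hence \<open>F\<^sub>j(k) > 1 / g(s k)\<close> for all large \<open>k\<close>. Then \<open>j\<close> satisfies (M),
  and at still lower slopes \<open>F\<^sub>i(x\<^sub>i) \<Sum>\<^bsub>l\<ge>x\<^sub>j\<^esub> 1 / F\<^sub>j(l) \<longrightarrow> 0\<close>. This quantity bounds the probability that \<open>i\<close> is ever drawn,
  so \<open>P(sMon\<^sub>i) \<longrightarrow> 0\<close> at points arbitrarily close to \<open>\<chi>\<close>, contradicting that \<open>\<chi>\<close> is interior to \<open>D\<^sub>i\<close>.\<close>

section \<open>The urn\<close>

lemma finite_agents [simp]: "finite (agents A)"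
  by (simp add: agents_def)

abbreviation unif01 :: "real measure" where
  "unif01 \<equiv> uniform_measure lborel {0..1}"

lemma prob_space_unif01: "prob_space unif01"
  by (rule prob_space_uniform_measure) auto

interpretation unif: sequence_space unif01
  by (simp add: sequence_space_def product_prob_space_def product_prob_space_axioms_def
      product_sigma_finite_def prob_space_unif01 prob_space_imp_sigma_finite)

lemma space_unif_seq [simp]: "space unif_seq = UNIV"
  by (simp add: unif_seq_def space_PiM)

interpretation useq: prob_space unif_seq
  unfolding unif_seq_def by (rule unif.P.prob_space_axioms)

section \<open>The law of a single draw\<close>

lemma urn_pick_in_agents:
  assumes "A \<ge> 1"
  shows "urn_pick A F x u \<in> agents A"
proof (cases "\<exists>i\<in>agents A. u * (\<Sum>j\<in>agents A. F j (real (x j))) < (\<Sum>j\<in>{1..i}. F j (real (x j)))")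
  case True
  then have "\<exists>i. i \<in> agents A \<and> u * (\<Sum>j\<in>agents A. F j (real (x j))) < (\<Sum>j\<in>{1..i}. F j (real (x j)))"
    by blast
  from LeastI_ex[OF this] show ?thesis using True by (simp add: urn_pick_def Let_def)
next
  case False
  then show ?thesis using assms by (simp add: urn_pick_def Let_def agents_def)
qed

lemma urn_pick_measurable [measurable]:
  "urn_pick A F x \<in> borel \<rightarrow>\<^sub>M count_space UNIV"
  unfolding urn_pick_def Let_def by measurable

text \<open>The partial sums increase, so drawing is inverse transform sampling: the least index
  whose partial sum exceeds \<open>u * S A\<close> is found by comparing with two consecutive sums.
  The clause \<open>c = A\<close> accounts for the default colour at \<open>u = 1\<close>.\<close>

lemma urn_pick_eq_iff:
  assumes pos: "\<And>j. j \<in> agents A \<Longrightarrow> 0 < F j (real (x j))"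
    and c: "c \<in> agents A" and u: "0 \<le> u" "u \<le> 1"
  defines "S \<equiv> \<lambda>k. \<Sum>j\<in>{1..k}. F j (real (x j))"
  shows "urn_pick A F x u = c \<longleftrightarrow> S (c - 1) \<le> u * S A \<and> (u * S A < S c \<or> c = A)"
proof -
  have mono: "S k \<le> S l" if "k \<le> l" "l \<le> A" for k l
    unfolding S_def using that pos by (intro sum_mono2) (auto simp: agents_def intro: less_imp_le)
  have tot: "(\<Sum>j\<in>agents A. F j (real (x j))) = S A"
    by (simp add: S_def agents_def)
  have SA: "0 \<le> S A" using mono[of 0 A] by (simp add: S_def)
  define Q where "Q = (\<lambda>i. i \<in> agents A \<and> u * S A < S i)"
  have pick: "urn_pick A F x u = (if \<exists>i. Q i then LEAST i. Q i else A)"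
    unfolding urn_pick_def Let_def tot Q_def Bex_def S_def ..
  \<comment> \<open>\<open>\<not> Q 0\<close> carries no information because \<open>0\<close> is not
    an agent; there \<open>S 0 = 0\<close> gives the bound. This case occurs as \<open>c - 1\<close>
    for \<open>c = 1\<close>.\<close>
  have nQ: "S k \<le> u * S A" if "\<not> Q k" "k \<le> A" for k
    using that SA u by (cases "k = 0") (auto simp: Q_def agents_def S_def)
  show ?thesis
  proof (cases "\<exists>i. Q i")
    case True
    show ?thesis
    proof
      assume "urn_pick A F x u = c"
      then have c_eq: "c = (LEAST i. Q i)" using pick True by simp
      then have "Q c" using LeastI_ex[OF True] by simp
      moreover have "\<not> Q (c - 1)"
        using c by (intro not_less_Least[where P = Q, folded c_eq]) (auto simp: agents_def)
      ultimately show "S (c - 1) \<le> u * S A \<and> (u * S A < S c \<or> c = A)"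
        using nQ[of "c - 1"] c by (auto simp: Q_def agents_def)
    next
      assume r: "S (c - 1) \<le> u * S A \<and> (u * S A < S c \<or> c = A)"
      have nq: "\<not> Q k" if "k < c" for k
      proof -
        have "k \<le> c - 1" "c - 1 \<le> A" using that c by (auto simp: agents_def)
        then show ?thesis using mono[of k "c - 1"] r by (auto simp: Q_def)
      qed
      from True obtain i where i: "Q i" by blast
      have "Q c"
      proof (cases "u * S A < S c")
        case True then show ?thesis using c by (simp add: Q_def)
      next
        case False
        then have "c = A" using r by simp
        with i have "i \<le> c" by (simp add: Q_def agents_def)
        with i nq[of i] have "i = c" by linarith
        with i show ?thesis by simp
      qed
      then have "(LEAST i. Q i) = c"
        by (rule Least_equality) (use nq not_less in blast)
      then show "urn_pick A F x u = c" using pick True by simp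
    qed
  next
    case False
    then have "urn_pick A F x u = A" using pick by simp
    moreover have "\<not> u * S A < S c" using False c by (auto simp: Q_def)
    moreover have "S (A - 1) \<le> u * S A" by (intro nQ) (use False in auto)
    ultimately show ?thesis by auto
  qed
qed

lemma prob_urn_pick:
  assumes pos: "\<And>j. j \<in> agents A \<Longrightarrow> 0 < F j (real (x j))"
    and c: "c \<in> agents A"
  shows "measure unif01 {u. urn_pick A F x u = c}
       = F c (real (x c)) / (\<Sum>j\<in>agents A. F j (real (x j)))"
proof -
  define S where "S = (\<lambda>k. \<Sum>j\<in>{1..k}. F j (real (x j)))"
  have tot: "(\<Sum>j\<in>agents A. F j (real (x j))) = S A"
    by (simp add: S_def agents_def)
  have mono: "S k \<le> S l" if "k \<le> l" "l \<le> A" for k l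
    unfolding S_def using that pos by (intro sum_mono2) (auto simp: agents_def intro: less_imp_le)
  have SA: "0 < S A"
    unfolding tot[symmetric] using c by (intro sum_pos pos) (auto simp: agents_def)
  have cA: "1 \<le> c" "c \<le> A" using c by (auto simp: agents_def)
  then have Sc: "S c = S (c - 1) + F c (real (x c))"
    by (cases c) (auto simp: S_def)
  have S0: "0 \<le> S (c - 1)" using mono[of 0 "c - 1"] cA by (simp add: S_def)
  have S1: "S (c - 1) \<le> S c" "S c \<le> S A" using mono cA by auto
  define l r where "l = S (c - 1) / S A" and "r = S c / S A"
  have lr: "0 \<le> l" "l \<le> r" "r \<le> 1" using S0 S1 SA by (auto simp: l_def r_def divide_right_mono)
  have iff: "urn_pick A F x u = c \<longleftrightarrow> l \<le> u \<and> (u < r \<or> c = A)" if "0 \<le> u" "u \<le> 1" for u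
  proof -
    have "urn_pick A F x u = c \<longleftrightarrow> S (c - 1) \<le> u * S A \<and> (u * S A < S c \<or> c = A)"
      unfolding S_def using pos c that by (rule urn_pick_eq_iff)
    then show ?thesis using SA by (simp add: l_def r_def field_simps)
  qed
  \<comment> \<open>Only the last interval is closed on the right, because the default sends
    \<open>u = 1\<close> to \<open>A\<close>; the endpoint does not change the length.\<close>
  have "{0..1} \<inter> {u. urn_pick A F x u = c} = (if c = A then {l..r} else {l..<r})"
  proof -
    have "r = 1" if "c = A" using that SA by (simp add: r_def)
    then show ?thesis using iff lr by (auto; fastforce)
  qed
  then have m: "measure lborel ({0..1} \<inter> {u. urn_pick A F x u = c}) = r - l"
    using lr by simp
  have [measurable]: "{u. urn_pick A F x u = c} \<in> sets lborel" by measurable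
  have "measure unif01 {u. urn_pick A F x u = c} = r - l"
    by (subst measure_uniform_measure) (use m in auto)
  also have "\<dots> = F c (real (x c)) / S A" using Sc SA by (simp add: l_def r_def diff_divide_distrib[symmetric])
  finally show ?thesis by (simp add: tot)
qed

section \<open>Decomposition at the first draw\<close>

definition urn_step :: "nat \<Rightarrow> (nat \<Rightarrow> real \<Rightarrow> real) \<Rightarrow> (nat \<Rightarrow> nat) \<Rightarrow> real \<Rightarrow> nat \<Rightarrow> nat" where
  "urn_step A F x u = x(urn_pick A F x u := Suc (x (urn_pick A F x u)))"

lemma urn_Suc: "urn A F x \<omega> (Suc n) = urn_step A F (urn A F x \<omega> n) (\<omega> n)"
  by (simp add: urn_step_def Let_def)

text \<open>The pathwise Markov property: once one uniform is consumed, the rest of the sequence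
  drives an urn started from the updated configuration. Later inductions use it to peel off the
  first draw.\<close>

lemma urn_case_nat:
  "urn A F x (case_nat u \<omega>) (Suc n) = urn A F (urn_step A F x u) \<omega> n"
proof (induction n)
  case 0
  show ?case by (simp add: urn_step_def Let_def)
next
  case (Suc n)
  show ?case by (subst urn_Suc, subst Suc.IH, subst urn_Suc) simp
qed

text \<open>The finite horizon \<open>n\<close> permits induction over the first draw for all
  starting configurations at once; the union over \<open>n\<close> is the event that
  \<open>i\<close> is ever drawn.\<close>

definition picked :: "nat \<Rightarrow> (nat \<Rightarrow> real \<Rightarrow> real) \<Rightarrow> nat \<Rightarrow> (nat \<Rightarrow> nat) \<Rightarrow> nat \<Rightarrow> (nat \<Rightarrow> real) set" where
  "picked A F i x n = {\<omega>. \<exists>m<n. urn_pick A F (urn A F x \<omega> m) (\<omega> m) = i}"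

lemma case_nat_in_picked:
  "case_nat u \<omega> \<in> picked A F i x (Suc n) \<longleftrightarrow>
     urn_pick A F x u = i \<or> \<omega> \<in> picked A F i (urn_step A F x u) n"
proof -
  have "(\<exists>m<Suc n. P m) \<longleftrightarrow> P 0 \<or> (\<exists>m<n. P (Suc m))" for P :: "nat \<Rightarrow> bool"
    by (auto simp: less_Suc_eq_0_disj)
  then show ?thesis
    unfolding picked_def by (simp add: urn_case_nat del: urn.simps(2))
qed

lemma component_measurable [measurable]: "(\<lambda>\<omega>. \<omega> n) \<in> unif_seq \<rightarrow>\<^sub>M borel"
proof -
  have "(\<lambda>\<omega>. \<omega> n) \<in> unif_seq \<rightarrow>\<^sub>M unif01"
    unfolding unif_seq_def by measurable
  moreover have "measurable unif_seq unif01 = borel_measurable unif_seq"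
    by (rule measurable_cong_sets) simp_all
  ultimately show ?thesis by simp
qed

lemma shift_measurable [measurable]: "(\<lambda>\<omega> n. \<omega> (Suc n)) \<in> unif_seq \<rightarrow>\<^sub>M unif_seq"
  unfolding unif_seq_def by (rule measurable_PiM_single') (auto simp: space_PiM)

text \<open>The first draw takes finitely many values. On each of them the event is the preimage
  under the shift of an event with a shorter horizon and a fixed starting configuration.\<close>

lemma picked_measurable [measurable]:
  assumes "A \<ge> 1"
  shows "picked A F i x n \<in> sets unif_seq"
proof (induction n arbitrary: x)
  case 0
  show ?case by (simp add: picked_def)
next
  case (Suc n)
  let ?step = "\<lambda>d. x(d := Suc (x d))"
  have *: "\<omega> \<in> picked A F i x (Suc n) \<longleftrightarrow> urn_pick A F x (\<omega> 0) = i \<or>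
      (\<exists>d\<in>agents A. urn_pick A F x (\<omega> 0) = d \<and> (\<lambda>n. \<omega> (Suc n)) \<in> picked A F i (?step d) n)" for \<omega>
  proof -
    have "\<omega> = case_nat (\<omega> 0) (\<lambda>n. \<omega> (Suc n))" by (auto split: nat.split)
    then show ?thesis
      using case_nat_in_picked[of "\<omega> 0" "\<lambda>n. \<omega> (Suc n)" A F i x n] urn_pick_in_agents[OF assms, of F x "\<omega> 0"]
      by (auto simp: urn_step_def)
  qed
  note [measurable] = Suc.IH
  have "{\<omega> \<in> space unif_seq. urn_pick A F x (\<omega> 0) = i \<or>
      (\<exists>d\<in>agents A. urn_pick A F x (\<omega> 0) = d \<and> (\<lambda>n. \<omega> (Suc n)) \<in> picked A F i (?step d) n)}
    \<in> sets unif_seq" (is "?S \<in> _") by measurable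
  also have "?S = picked A F i x (Suc n)" using * by auto
  finally show ?case .
qed

section \<open>Tail sums and the upper bound for strong monopoly\<close>

lemma tail_sum_Suc:
  assumes "cond_M F j" "k \<ge> 1"
  shows "tail_sum F j k = 1 / F j (real k) + tail_sum F j (Suc k)"
    and "summable (\<lambda>l. 1 / F j (real (l + k)))"
proof -
  obtain k' where k: "k = Suc k'" using assms by (cases k) auto
  show sm: "summable (\<lambda>l. 1 / F j (real (l + k)))"
    using assms(1) unfolding cond_M_def
    by (subst (asm) summable_iff_shift[of _ k', symmetric]) (simp add: k)
  show "tail_sum F j k = 1 / F j (real k) + tail_sum F j (Suc k)"
    using suminf_split_head[OF sm] by (simp add: tail_sum_def)
qed

lemma tail_sum_pos:
  assumes "cond_M F j" "\<forall>x>0. 0 < F j x" "k \<ge> 1"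
  shows "0 < tail_sum F j k"
  unfolding tail_sum_def using assms by (intro suminf_pos tail_sum_Suc(2)) auto

text \<open>While \<open>i\<close> has not been drawn, \<open>F\<^sub>i(x\<^sub>i) \<Sum>\<^bsub>l\<ge>x\<^sub>j\<^esub> 1 / F\<^sub>j(l)\<close> is a supermartingale along the urn
  that bounds the probability of drawing \<open>i\<close> in the next step; this replaces the comparison of the explosion
  times of \<open>i\<close> and \<open>j\<close> in the exponential embedding.\<close>

lemma emeasure_picked_le:
  assumes ij: "i \<in> agents A" "j \<in> agents A" "i \<noteq> j"
    and F: "\<And>l z. l \<in> agents A \<Longrightarrow> 0 < z \<Longrightarrow> 0 < F l z"
    and M: "cond_M F j"
    and x: "\<And>l. l \<in> agents A \<Longrightarrow> 1 \<le> x l"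
  shows "emeasure unif_seq (picked A F i x n) \<le> ennreal (F i (real (x i)) * tail_sum F j (x j))"
  using x
proof (induction n arbitrary: x)
  case 0
  show ?case by (simp add: picked_def)
next
  case (Suc n)
  have A1: "A \<ge> 1" using ij by (auto simp: agents_def)
  note [measurable] = picked_measurable[OF A1]
  have Fx: "0 < F l (real (x l))" if "l \<in> agents A" for l
    using F[OF that] Suc.prems[OF that] by simp
  define f where "f = F i (real (x i))"
  define fj where "fj = F j (real (x j))"
  define tot where "tot = (\<Sum>l\<in>agents A. F l (real (x l)))"
  define h where "h = f * tail_sum F j (x j)"
  have pos: "0 < f" "0 < fj" using Fx ij by (auto simp: f_def fj_def)
  have tot: "0 < tot"
    unfolding tot_def using Fx ij by (intro sum_pos) (auto simp: agents_def)
  have tail: "tail_sum F j (x j) = 1 / fj + tail_sum F j (Suc (x j))"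
    unfolding fj_def using M Suc.prems ij by (intro tail_sum_Suc) auto
  have tpos: "0 < tail_sum F j (Suc (x j))"
    using M F ij by (intro tail_sum_pos) auto
  \<comment> \<open>Since \<open>h\<close> contains the leading term \<open>1 / fj\<close> of the
    tail, it dominates \<open>f / fj\<close>, the odds of \<open>i\<close> against \<open>j\<close>;
    hence \<open>B\<close> is nonnegative.\<close>
  have hge: "f / fj \<le> h" unfolding h_def tail using pos tpos by (simp add: algebra_simps)
  define p where "p = urn_pick A F x"
  have [measurable]: "p \<in> borel \<rightarrow>\<^sub>M count_space UNIV" unfolding p_def by measurable
  \<comment> \<open>The bound after one draw, as a function of \<open>u\<close>: it is
    \<open>1\<close> if \<open>i\<close> is drawn, \<open>h - f / fj\<close> (the tail loses its
    leading term) if \<open>j\<close> is drawn, and \<open>h\<close> otherwise.\<close>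
  define B where "B = (\<lambda>u. h + (1 - h) * indicator {u. p u = i} u - (f / fj) * indicator {u. p u = j} u)"
  have B0: "0 \<le> B u" for u
    using hge pos ij by (auto simp: B_def indicator_def intro: order_trans[OF _ hge])
  have sets: "{u. p u = c} \<in> sets unif01" for c
    by measurable
  have int: "integrable unif01 (indicat_real {u. p u = c})" for c
  proof (rule unif.M.integrable_const_bound[of _ 1])
    show "AE u in unif01. norm (indicat_real {u. p u = c} u) \<le> 1"
      by (intro AE_I2) (simp add: indicator_def)
    show "indicat_real {u. p u = c} \<in> borel_measurable unif01"
      by (rule borel_measurable_indicator) (rule sets)
  qed
  have prob: "(\<integral>u. indicat_real {u. p u = c} u \<partial>unif01) = F c (real (x c)) / tot"
    if "c \<in> agents A" for c
  proof -
    have "measure unif01 {u. p u = c} = F c (real (x c)) / tot"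
      unfolding p_def tot_def using Fx that by (rule prob_urn_pick)
    then show ?thesis
      by (simp only: Bochner_Integration.integral_indicator Int_UNIV_right
        space_uniform_measure space_lborel space_borel)
  qed
  have emb: "(\<lambda>(u, \<omega>). case_nat u \<omega>) \<in> unif01 \<Otimes>\<^sub>M unif_seq \<rightarrow>\<^sub>M unif_seq"
    unfolding unif_seq_def by measurable
  \<comment> \<open>\<open>PiM_iter\<close> writes the law of the sequence as that of a first
    uniform followed by an independent copy, so Fubini conditions on the first draw.\<close>
  have "emeasure unif_seq (picked A F i x (Suc n))
      = emeasure (distr (unif01 \<Otimes>\<^sub>M unif_seq) unif_seq (\<lambda>(u, \<omega>). case_nat u \<omega>)) (picked A F i x (Suc n))"
    using unif.PiM_iter by (simp add: unif_seq_def)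
  also have "\<dots> = emeasure (unif01 \<Otimes>\<^sub>M unif_seq)
      ((\<lambda>(u, \<omega>). case_nat u \<omega>) -` picked A F i x (Suc n) \<inter> space (unif01 \<Otimes>\<^sub>M unif_seq))"
    using emb by (rule emeasure_distr) measurable
  also have "\<dots> = (\<integral>\<^sup>+u. emeasure unif_seq (Pair u -`
      ((\<lambda>(u, \<omega>). case_nat u \<omega>) -` picked A F i x (Suc n) \<inter> space (unif01 \<Otimes>\<^sub>M unif_seq))) \<partial>unif01)"
    using emb by (intro useq.emeasure_pair_measure_alt measurable_sets[OF emb]) measurable
  also have "\<dots> \<le> (\<integral>\<^sup>+u. ennreal (B u) \<partial>unif01)"
  proof (rule nn_integral_mono)
    fix u :: real
    have eq: "Pair u -` ((\<lambda>(u, \<omega>). case_nat u \<omega>) -` picked A F i x (Suc n) \<inter> space (unif01 \<Otimes>\<^sub>M unif_seq))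
        = (if p u = i then UNIV else picked A F i (x(p u := Suc (x (p u)))) n)"
      by (auto simp: case_nat_in_picked space_pair_measure p_def urn_step_def)
    show "emeasure unif_seq (Pair u -`
      ((\<lambda>(u, \<omega>). case_nat u \<omega>) -` picked A F i x (Suc n) \<inter> space (unif01 \<Otimes>\<^sub>M unif_seq))) \<le> ennreal (B u)"
    proof (cases "p u = i")
      case True
      then show ?thesis
        unfolding eq using useq.emeasure_space_1 ij by (simp add: B_def)
    next
      case False
      let ?x = "x(p u := Suc (x (p u)))"
      have "emeasure unif_seq (picked A F i ?x n) \<le> ennreal (F i (real (?x i)) * tail_sum F j (?x j))"
        by (rule Suc.IH) (use Suc.prems in auto)
      also have "F i (real (?x i)) * tail_sum F j (?x j) = B u"
        using False tail pos by (auto simp: B_def h_def f_def[symmetric] field_simps)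
      finally show ?thesis unfolding eq by (simp only: False if_False)
    qed
  qed
  also have "\<dots> = ennreal (\<integral>u. B u \<partial>unif01)"
  proof (rule nn_integral_eq_integral)
    show "integrable unif01 B"
      unfolding B_def
      by (rule Bochner_Integration.integrable_diff[OF Bochner_Integration.integrable_add
          [OF unif.M.integrable_const integrable_mult_right[OF int]] integrable_mult_right[OF int]])
    show "AE u in unif01. 0 \<le> B u"
      by (intro AE_I2 B0)
  qed
  also have "(\<integral>u. B u \<partial>unif01) = h + (1 - h) * (f / tot) - (f / fj) * (fj / tot)"
    unfolding B_def
    by (subst Bochner_Integration.integral_diff[OF Bochner_Integration.integrable_add
          [OF unif.M.integrable_const integrable_mult_right[OF int]] integrable_mult_right[OF int]],
        subst Bochner_Integration.integral_add
          [OF unif.M.integrable_const integrable_mult_right[OF int]])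
      (simp only: integral_mult_right_zero prob[OF ij(1)] prob[OF ij(2)] f_def fj_def
        unif.M.prob_space lebesgue_integral_const scaleR_one)
  \<comment> \<open>With \<open>fj\<close> cancelled, the mean is
    \<open>h + (1 - h) * (f / tot) - f / tot = h * (1 - f / tot)\<close>: the loss from drawing
    \<open>j\<close> outweighs the gain from drawing \<open>i\<close>.\<close>
  also have "ennreal (h + (1 - h) * (f / tot) - (f / fj) * (fj / tot)) \<le> ennreal h"
    using pos tot hge order.trans[OF _ hge, of 0] by (intro ennreal_leI) (simp add: field_simps)
  finally show ?case by (simp add: h_def f_def)
qed

text \<open>Every ball then goes to a competitor of \<open>i\<close>, so their total grows by one
  per step. This excludes \<open>sMon\<close> when \<open>i\<close> is never drawn.\<close>

lemma sum_urn_not_picked: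
  assumes i: "i \<in> agents A" and never: "\<And>m. urn_pick A F (urn A F x \<omega> m) (\<omega> m) \<noteq> i"
  shows "(\<Sum>j\<in>agents A - {i}. urn A F x \<omega> n j) = (\<Sum>j\<in>agents A - {i}. x j) + n"
proof (induction n)
  case 0
  show ?case by simp
next
  case (Suc n)
  let ?c = "urn_pick A F (urn A F x \<omega> n) (\<omega> n)"
  have c: "?c \<in> agents A - {i}"
    using urn_pick_in_agents[of A] never i by (auto simp: agents_def)
  have "(\<Sum>j\<in>agents A - {i}. urn A F x \<omega> (Suc n) j)
      = (\<Sum>j\<in>agents A - {i}. urn A F x \<omega> n j + (if j = ?c then 1 else 0))"
    by (intro sum.cong) (auto simp: urn_Suc urn_step_def simp del: urn.simps(2))
  also have "\<dots> = (\<Sum>j\<in>agents A - {i}. urn A F x \<omega> n j) + 1"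
    using c by (simp add: sum.distrib)
  finally show ?case using Suc.IH by simp
qed

text \<open>On \<open>sMon\<close> agent \<open>i\<close> must be drawn at some time, as otherwise
  the total of its competitors diverges. The finite-horizon bounds pass to this event by continuity
  from below.\<close>

lemma prob_sMon_le:
  assumes ij: "i \<in> agents A" "j \<in> agents A" "i \<noteq> j"
    and F: "\<And>l z. l \<in> agents A \<Longrightarrow> 0 < z \<Longrightarrow> 0 < F l z"
    and M: "cond_M F j"
    and x: "\<And>l. l \<in> agents A \<Longrightarrow> 1 \<le> init_config chi N l"
  shows "measure unif_seq (sMon A F i chi N)
    \<le> F i (real (init_config chi N i)) * tail_sum F j (init_config chi N j)"
proof -
  let ?x = "init_config chi N"
  have A1: "A \<ge> 1" using ij by (auto simp: agents_def)
  note [measurable] = picked_measurable[OF A1]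
  have nonneg: "0 \<le> F i (real (?x i)) * tail_sum F j (?x j)"
    using F[of i "real (?x i)"] x ij tail_sum_pos[OF M, of "?x j"] F[of j]
    by (intro mult_nonneg_nonneg less_imp_le) (auto simp: Suc_le_eq)
  have le: "measure unif_seq (picked A F i ?x n) \<le> F i (real (?x i)) * tail_sum F j (?x j)" for n
    using emeasure_picked_le[of i A j F ?x n] ij F M x nonneg
    by (simp add: useq.emeasure_eq_measure)
  have "sMon A F i chi N \<subseteq> (\<Union>n. picked A F i ?x n)"
  proof (rule subsetI, rule ccontr)
    fix \<omega> assume sm: "\<omega> \<in> sMon A F i chi N" and np: "\<omega> \<notin> (\<Union>n. picked A F i ?x n)"
    have never: "urn_pick A F (urn A F ?x \<omega> m) (\<omega> m) \<noteq> i" for m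
      using np unfolding picked_def by blast
    have "convergent (\<lambda>n. real ((\<Sum>j\<in>agents A - {i}. ?x j) + n))"
      using sm unfolding sMon_def by (simp only: mem_Collect_eq sum_urn_not_picked[OF ij(1) never])
    then have "Bseq (\<lambda>n. real ((\<Sum>j\<in>agents A - {i}. ?x j) + n))"
      by (rule convergent_imp_Bseq)
    then obtain K where K: "\<And>n. \<bar>real ((\<Sum>j\<in>agents A - {i}. ?x j) + n)\<bar> \<le> K"
      unfolding Bseq_def by auto
    show False using K[of "nat \<lceil>K\<rceil> + 1"] by linarith
  qed
  then have "measure unif_seq (sMon A F i chi N) \<le> measure unif_seq (\<Union>n. picked A F i ?x n)"
    by (rule useq.finite_measure_mono) measurable
  also have "\<dots> \<le> F i (real (?x i)) * tail_sum F j (?x j)"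
  proof (rule LIMSEQ_le_const2)
    show "(\<lambda>n. measure unif_seq (picked A F i ?x n)) \<longlonglongrightarrow> measure unif_seq (\<Union>n. picked A F i ?x n)"
      by (rule useq.finite_Lim_measure_incseq)
        (auto simp: incseq_def picked_def intro: less_le_trans picked_measurable[OF A1, unfolded picked_def])
  qed (use le in auto)
  finally show ?thesis .
qed

section \<open>Total monopoly and its lower bound\<close>

lemma tMon_eq:
  assumes i: "i \<in> agents A"
  shows "tMon A F i chi N = {\<omega>. \<forall>n. urn_pick A F
    ((init_config chi N)(i := init_config chi N i + n)) (\<omega> n) = i}"
proof -
  let ?x = "init_config chi N"
  let ?y = "\<lambda>n. ?x(i := ?x i + n)"
  \<comment> \<open>As long as only \<open>i\<close> is drawn, the urn follows the deterministic
    path \<open>?y\<close>. The event can thus be expressed without the random state, and any first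
    deviation changes some component \<open>j \<noteq> i\<close>.\<close>
  have urn: "urn A F ?x \<omega> n = ?y n" if "\<And>m. m < n \<Longrightarrow> urn_pick A F (?y m) (\<omega> m) = i" for \<omega> n
    using that by (induction n) (auto simp: urn_Suc urn_step_def simp del: urn.simps(2))
  show ?thesis
  proof (intro equalityI subsetI)
    fix \<omega> assume t: "\<omega> \<in> tMon A F i chi N"
    have "urn_pick A F (?y n) (\<omega> n) = i" for n
    proof (induction n rule: less_induct)
      case (less n)
      have u: "urn A F ?x \<omega> n = ?y n" by (rule urn) (rule less)
      let ?c = "urn_pick A F (?y n) (\<omega> n)"
      show ?case
      proof (rule ccontr)
        assume c: "?c \<noteq> i"
        have "?c \<in> agents A" using i by (intro urn_pick_in_agents) (auto simp: agents_def)
        then have "urn A F ?x \<omega> (Suc n) ?c = ?x ?c"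
          using t c by (simp add: tMon_def del: urn.simps)
        then show False
          using c by (simp add: urn_Suc urn_step_def u del: urn.simps)
      qed
    qed
    then show "\<omega> \<in> {\<omega>. \<forall>n. urn_pick A F (?y n) (\<omega> n) = i}" by blast
  next
    fix \<omega> assume "\<omega> \<in> {\<omega>. \<forall>n. urn_pick A F (?y n) (\<omega> n) = i}"
    then show "\<omega> \<in> tMon A F i chi N" by (simp add: tMon_def urn)
  qed
qed

lemma prob_tMon_ge:
  assumes i: "i \<in> agents A"
    and F: "\<And>l z. l \<in> agents A \<Longrightarrow> 0 < z \<Longrightarrow> 0 < F l z"
    and M: "cond_M F i"
    and x: "\<And>l. l \<in> agents A \<Longrightarrow> 1 \<le> init_config chi N l"
  shows "measure unif_seq (tMon A F i chi N)
    \<ge> 1 - (\<Sum>j\<in>agents A - {i}. F j (real (init_config chi N j))) * tail_sum F i (init_config chi N i)"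
proof -
  let ?x = "init_config chi N"
  let ?y = "\<lambda>n. ?x(i := ?x i + n)"
  define S where "S = (\<Sum>j\<in>agents A - {i}. F j (real (?x j)))"
  have S0: "0 \<le> S"
    unfolding S_def using F x by (intro sum_nonneg less_imp_le) (auto simp: Suc_le_eq)
  \<comment> \<open>The draw is taken at the deterministic state \<open>?y n\<close>, so
    \<open>E n\<close> depends on the single coordinate \<open>\<omega> n\<close> and its
    probability comes from the marginal law.\<close>
  define E where "E = (\<lambda>n. {\<omega>. urn_pick A F (?y n) (\<omega> n) \<noteq> i})"
  have Em: "E n \<in> sets unif_seq" for n
  proof -
    have "{\<omega> \<in> space unif_seq. urn_pick A F (?y n) (\<omega> n) \<noteq> i} \<in> sets unif_seq" by measurable
    then show ?thesis by (simp add: E_def)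
  qed
  have pos: "0 < F l (real (?y n l))" if "l \<in> agents A" for l n
    using x[OF that] by (intro F that) auto
  have E_le: "measure unif_seq (E n) \<le> S * (1 / F i (real (n + ?x i)))" for n
  proof -
    let ?fi = "F i (real (n + ?x i))"
    let ?B = "{u. urn_pick A F (?y n) u = i}"
    have fi: "0 < ?fi" using pos[OF i, of n] by (simp add: add.commute)
    have tot: "(\<Sum>j\<in>agents A. F j (real (?y n j))) = ?fi + S"
      unfolding S_def using i by (subst sum.remove[of _ i]) (auto simp: add.commute intro!: sum.cong)
    have "?B \<in> sets borel" by measurable
    then have Bm: "?B \<in> sets unif01" by simp
    have "E n = (\<lambda>\<omega>. \<omega> n) -` (UNIV - ?B) \<inter> space unif_seq"
      by (auto simp: E_def)
    then have "measure unif_seq (E n) = measure (distr unif_seq unif01 (\<lambda>\<omega>. \<omega> n)) (UNIV - ?B)"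
      using Bm by (subst measure_distr) (auto simp: unif_seq_def)
    also have "distr unif_seq unif01 (\<lambda>\<omega>. \<omega> n) = unif01"
      unfolding unif_seq_def by (rule unif.PiM_component) simp
    also have "measure unif01 (UNIV - ?B) = 1 - measure unif01 ?B"
      using unif.M.prob_compl[OF Bm] by simp
    also have "measure unif01 ?B = ?fi / (?fi + S)"
    proof -
      have "measure unif01 ?B = F i (real (?y n i)) / (\<Sum>j\<in>agents A. F j (real (?y n j)))"
        using pos i by (rule prob_urn_pick)
      then show ?thesis unfolding tot by (simp add: add.commute)
    qed
    also have "1 - ?fi / (?fi + S) = S / (?fi + S)"
      using fi S0 by (simp add: field_simps)
    also have "\<dots> \<le> S / ?fi"
      using fi S0 by (intro divide_left_mono) auto
    finally show ?thesis by simp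
  qed
  have sm: "summable (\<lambda>n. S * (1 / F i (real (n + ?x i))))"
    using tail_sum_Suc(2)[OF M x[OF i]] by (rule summable_mult)
  have smE: "summable (\<lambda>n. measure unif_seq (E n))"
    by (rule summable_comparison_test'[OF sm, of 0]) (use E_le in auto)
  have "measure unif_seq (\<Union>n. E n) \<le> (\<Sum>n. measure unif_seq (E n))"
    by (rule useq.finite_measure_subadditive_countably) (use Em smE in auto)
  also have "\<dots> \<le> (\<Sum>n. S * (1 / F i (real (n + ?x i))))"
    using E_le smE sm by (rule suminf_le)
  also have "\<dots> = S * tail_sum F i (?x i)"
    unfolding tail_sum_def by (rule suminf_mult) (rule tail_sum_Suc(2)[OF M x[OF i]])
  finally have le: "measure unif_seq (\<Union>n. E n) \<le> S * tail_sum F i (?x i)" .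
  have "tMon A F i chi N = space unif_seq - (\<Union>n. E n)"
    unfolding tMon_eq[OF i] E_def by auto
  then have "measure unif_seq (tMon A F i chi N) = 1 - measure unif_seq (\<Union>n. E n)"
    using Em by (simp only:) (rule useq.prob_compl, auto)
  with le show ?thesis by (simp add: S_def)
qed

section \<open>Geometric decay and the oscillation argument\<close>

text \<open>If \<open>F i k * tail_sum F i k\<close> is bounded, the leading term is at least a
  fixed fraction of the tail, so dropping it shrinks the tail by a constant factor.\<close>

lemma type_E_decay:
  assumes E: "type_E F i" and pos: "\<forall>x>0. 0 < F i x"
  obtains C q where "0 < C" "0 < q" "q < 1"
    "\<And>k. k \<ge> 1 \<Longrightarrow> F i (real k) * tail_sum F i k \<le> C"
    "\<And>m n. 1 \<le> m \<Longrightarrow> m \<le> n \<Longrightarrow> tail_sum F i n \<le> q ^ (n - m) * tail_sum F i m"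
proof -
  have M: "cond_M F i" using E by (simp add: type_E_def)
  define a where "a = (\<lambda>k. F i (real k) * tail_sum F i k)"
  have "limsup (\<lambda>k. ereal (a k)) < \<infinity>" using E by (simp add: type_E_def a_def)
  then obtain B where "limsup (\<lambda>k. ereal (a k)) < ereal B"
    using less_PInf_Ex_of_nat by (metis ereal_dense2)
  then have "\<forall>\<^sub>F k in sequentially. ereal (a k) < ereal B" by (rule Limsup_lessD)
  then obtain K where K: "\<And>k. k \<ge> K \<Longrightarrow> a k < B"
    by (auto simp: eventually_sequentially)
  \<comment> \<open>The limsup controls only \<open>k \<ge> K\<close>; the finite maximum covers the
    earlier indices, and the entry \<open>1\<close> makes \<open>C\<close> positive.\<close>
  define C where "C = Max (insert 1 (insert B (a ` {..<K})))"
  have C: "1 \<le> C" "B \<le> C" unfolding C_def by (rule Max_ge; simp)+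
  have aC: "a k \<le> C" for k
  proof (cases "k < K")
    case True then show ?thesis unfolding C_def by (intro Max_ge) auto
  next
    case False then show ?thesis using K[of k] C by simp
  qed
  \<comment> \<open>\<open>C + 1\<close> instead of \<open>C\<close> keeps \<open>q\<close> positive
    even for \<open>C = 1\<close>.\<close>
  define q where "q = 1 - 1 / (C + 1)"
  have q: "0 < q" "q < 1" using C by (auto simp: q_def field_simps)
  have tail_step: "tail_sum F i (Suc k) \<le> q * tail_sum F i k" if "k \<ge> 1" for k
  proof -
    have f: "0 < F i (real k)" using that pos by simp
    have g: "0 < tail_sum F i k" by (rule tail_sum_pos[OF M pos that])
    have "tail_sum F i k \<le> (C + 1) * (1 / F i (real k))"
      using aC[of k] f g by (simp add: a_def field_simps)
    then have "tail_sum F i k / (C + 1) \<le> 1 / F i (real k)"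
      using C by (simp add: divide_le_eq mult.commute)
    moreover have "q * tail_sum F i k = tail_sum F i k - tail_sum F i k / (C + 1)"
      by (simp add: q_def left_diff_distrib)
    ultimately show ?thesis
      using tail_sum_Suc(1)[OF M that] by linarith
  qed
  have "tail_sum F i n \<le> q ^ (n - m) * tail_sum F i m" if "1 \<le> m" "m \<le> n" for m n
    using that(2)
  proof (induction n rule: dec_induct)
    case base
    show ?case by simp
  next
    case (step n)
    have "tail_sum F i (Suc n) \<le> q * tail_sum F i n"
      using step.hyps that(1) by (intro tail_step) simp
    also have "\<dots> \<le> q * (q ^ (n - m) * tail_sum F i m)"
      using step.IH q by simp
    finally show ?case using step.hyps by (simp add: Suc_diff_le)
  qed
  then show ?thesis
    using that[of C q] C q aC by (auto simp: a_def)
qed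

text \<open>\<open>high\<close> and \<open>low\<close> make the sets \<open>V M\<close> and
  \<open>W M\<close> dense, and continuity makes them relatively open, so by Baire they have a
  common point. Taking \<open>M \<ge> 1\<close> keeps \<open>N \<ge> 1\<close>, where continuity is
  available.\<close>

lemma Baire_oscillation:
  fixes \<rho> :: "nat \<Rightarrow> real \<Rightarrow> real"
  assumes ab: "a < b"
    and cont: "\<And>N. N \<ge> 1 \<Longrightarrow> continuous_on {a..b} (\<rho> N)"
    and high: "\<And>x y M. 1 \<le> M \<Longrightarrow> a \<le> x \<Longrightarrow> x < y \<Longrightarrow> y \<le> b \<Longrightarrow> \<exists>N\<ge>M. \<exists>t\<in>{x<..<y}. \<rho> N t > real M"
    and low: "\<And>x y M. 1 \<le> M \<Longrightarrow> a \<le> x \<Longrightarrow> x < y \<Longrightarrow> y \<le> b \<Longrightarrow> \<exists>N\<ge>M. \<exists>t\<in>{x<..<y}. \<rho> N t < 1 / real M"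
  shows "\<exists>t\<in>{a..b}. \<forall>M\<ge>1. (\<exists>N\<ge>M. \<rho> N t > real M) \<and> (\<exists>N\<ge>M. \<rho> N t < 1 / real M)"
proof -
  define V where "V = (\<lambda>M. {t \<in> {a..b}. \<exists>N\<ge>M. \<rho> N t > real M})"
  define W where "W = (\<lambda>M. {t \<in> {a..b}. \<exists>N\<ge>M. \<rho> N t < 1 / real M})"
  have dense: "{a..b} \<subseteq> closure T"
    if T: "\<And>x y. a \<le> x \<Longrightarrow> x < y \<Longrightarrow> y \<le> b \<Longrightarrow> \<exists>t\<in>{x<..<y}. t \<in> T" for T :: "real set"
  proof
    fix x assume x: "x \<in> {a..b}"
    show "x \<in> closure T"
    proof (rule closure_approachable[THEN iffD2], intro allI impI)
      fix e :: real assume e: "0 < e"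
      \<comment> \<open>Clipping the ball to \<open>{a..b}\<close> leaves a nondegenerate interval
        even around an endpoint.\<close>
      have "max a (x - e) < min b (x + e)" using x e ab by auto
      then obtain t where "t \<in> {max a (x - e)<..<min b (x + e)}" "t \<in> T"
        using T[of "max a (x - e)" "min b (x + e)"] by auto
      then show "\<exists>y\<in>T. dist y x < e" by (intro bexI[of _ t]) (auto simp: dist_real_def)
    qed
  qed
  have "openin (top_of_set {a..b}) T \<and> {a..b} \<subseteq> closure T" if T: "T \<in> V ` {1..} \<union> W ` {1..}" for T
  proof -
    from T consider M where "M \<ge> 1" "T = V M" | M where "M \<ge> 1" "T = W M" by auto
    then show ?thesis
    proof cases
      case 1
      have "V M = (\<Union>N\<in>{M..}. {a..b} \<inter> \<rho> N -` {real M<..})" by (auto simp: V_def)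
      moreover have "openin (top_of_set {a..b}) (\<Union>N\<in>{M..}. {a..b} \<inter> \<rho> N -` {real M<..})"
        using 1 by (intro openin_Union) (auto intro!: continuous_openin_preimage_gen cont)
      ultimately have "openin (top_of_set {a..b}) (V M)" by (simp only:)
      moreover have "{a..b} \<subseteq> closure (V M)"
      proof (rule dense)
        fix x y assume "a \<le> x" "x < y" "y \<le> b"
        with 1 high[of M x y] show "\<exists>t\<in>{x<..<y}. t \<in> V M" by (fastforce simp: V_def)
      qed
      ultimately show ?thesis using 1 by simp
    next
      case 2
      have "W M = (\<Union>N\<in>{M..}. {a..b} \<inter> \<rho> N -` {..<1 / real M})" by (auto simp: W_def)
      moreover have "openin (top_of_set {a..b}) (\<Union>N\<in>{M..}. {a..b} \<inter> \<rho> N -` {..<1 / real M})"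
        using 2 by (intro openin_Union) (auto intro!: continuous_openin_preimage_gen cont)
      ultimately have "openin (top_of_set {a..b}) (W M)" by (simp only:)
      moreover have "{a..b} \<subseteq> closure (W M)"
      proof (rule dense)
        fix x y assume "a \<le> x" "x < y" "y \<le> b"
        with 2 low[of M x y] show "\<exists>t\<in>{x<..<y}. t \<in> W M" by (fastforce simp: W_def)
      qed
      ultimately show ?thesis using 2 by simp
    qed
  qed
  then have "{a..b} \<subseteq> closure (\<Inter>(V ` {1..} \<union> W ` {1..}))"
    by (intro Baire) auto
  then have "\<Inter>(V ` {1..} \<union> W ` {1..}) \<noteq> {}" using ab by auto
  then obtain t where t: "\<And>M. M \<ge> 1 \<Longrightarrow> t \<in> V M \<and> t \<in> W M" by fastforce
  then have "t \<in> {a..b}" unfolding V_def by blast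
  with t show ?thesis unfolding V_def W_def by blast
qed

lemma liminf_0_limsup_infinity:
  fixes \<rho> :: "nat \<Rightarrow> real"
  assumes nonneg: "\<And>N. N \<ge> 1 \<Longrightarrow> 0 \<le> \<rho> N"
    and osc: "\<forall>M\<ge>1. (\<exists>N\<ge>M. \<rho> N > real M) \<and> (\<exists>N\<ge>M. \<rho> N < 1 / real M)"
  shows "liminf (\<lambda>N. ereal (\<rho> N)) = 0 \<and> limsup (\<lambda>N. ereal (\<rho> N)) = \<infinity>"
proof
  have "0 \<le> liminf (\<lambda>N. ereal (\<rho> N))"
    by (rule Liminf_bounded) (use nonneg in \<open>auto simp: eventually_sequentially intro!: exI[of _ 1]\<close>)
  moreover have "\<not> 0 < liminf (\<lambda>N. ereal (\<rho> N))"
  proof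
    assume "0 < liminf (\<lambda>N. ereal (\<rho> N))"
    then obtain c where c: "0 < ereal c" "ereal c < liminf (\<lambda>N. ereal (\<rho> N))"
      using ereal_dense2 by blast
    from less_LiminfD[OF c(2)] obtain K where K: "\<And>N. N \<ge> K \<Longrightarrow> c < \<rho> N"
      by (auto simp: eventually_sequentially)
    \<comment> \<open>In \<open>osc\<close> the same \<open>M\<close> bounds the index and the
      value, so it has to pass both \<open>K\<close> and \<open>1 / c\<close>.\<close>
    define M where "M = max (Suc K) (nat \<lceil>1 / c\<rceil>)"
    have M: "M \<ge> K" "M \<ge> 1" "1 / c \<le> real M" by (auto simp: M_def) linarith
    obtain N where N: "N \<ge> M" "\<rho> N < 1 / real M" using osc M by blast
    have "1 / real M \<le> c" using M c by (simp add: field_simps)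
    then show False using K[of N] N M by simp
  qed
  ultimately show "liminf (\<lambda>N. ereal (\<rho> N)) = 0" by simp
  show "limsup (\<lambda>N. ereal (\<rho> N)) = \<infinity>"
  proof (rule ccontr)
    assume "limsup (\<lambda>N. ereal (\<rho> N)) \<noteq> \<infinity>"
    then have "limsup (\<lambda>N. ereal (\<rho> N)) < \<infinity>" by simp
    then obtain B where "limsup (\<lambda>N. ereal (\<rho> N)) < ereal B"
      by (metis ereal_dense2)
    from Limsup_lessD[OF this] obtain K where K: "\<And>N. N \<ge> K \<Longrightarrow> \<rho> N < B"
      by (auto simp: eventually_sequentially)
    define M where "M = max (Suc K) (nat \<lceil>B\<rceil>)"
    have M: "M \<ge> K" "M \<ge> 1" "B \<le> real M" by (auto simp: M_def) linarith
    obtain N where N: "N \<ge> M" "\<rho> N > real M" using osc M by blast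
    then show False using K[of N] M by simp
  qed
qed

text \<open>The condition on \<open>t\<close> means that \<open>N\<close> lies strictly between
  \<open>k / (p + b)\<close> and \<open>k / (p + a)\<close>. The length of this interval is
  proportional to \<open>k\<close>, so it eventually contains an integer beyond
  \<open>M\<close>.\<close>

lemma eventually_grid_point:
  assumes p: "0 < p + a" and ab: "a < b"
  shows "\<forall>\<^sub>F k in sequentially. \<exists>N\<ge>M. \<exists>t. a < t \<and> t < b \<and> (p + t) * real N = real k"
proof -
  define d where "d = 1 / (p + a) - 1 / (p + b)"
  have d: "0 < d" using p ab by (simp add: d_def divide_strict_left_mono)
  define K where "K = nat \<lceil>2 / d\<rceil> + nat \<lceil>(p + b) * (real M + 1)\<rceil>"
  have "\<exists>N\<ge>M. \<exists>t. a < t \<and> t < b \<and> (p + t) * real N = real k" if "k \<ge> K" for k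
  proof -
    have "2 / d \<le> real k" "(p + b) * (real M + 1) \<le> real k"
      using that unfolding K_def by linarith+
    then have kd: "2 \<le> real k * d" and kM: "real M + 1 \<le> real k / (p + b)"
      using d p ab by (auto simp: field_simps)
    define N where "N = nat \<lfloor>real k / (p + b)\<rfloor> + 1"
    have N: "real k / (p + b) < real N" "real N \<le> real k / (p + b) + 1"
      using kM unfolding N_def by linarith+
    have "real k / (p + a) = real k / (p + b) + real k * d"
      by (simp add: d_def algebra_simps)
    then have N2: "real N < real k / (p + a)" using N kd by simp
    have NM: "N \<ge> M" "0 < real N" using kM N by linarith+
    show ?thesis
    proof (intro exI[of _ N] exI[of _ "real k / real N - p"] conjI NM)
      show "a < real k / real N - p" using N2 NM p by (simp add: field_simps)
      show "real k / real N - p < b" using N NM p ab by (simp add: field_simps)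
      show "(p + (real k / real N - p)) * real N = real k" using NM by simp
    qed
  qed
  then show ?thesis by (auto simp: eventually_sequentially)
qed

text \<open>The index gap grows like \<open>(\<beta> - \<alpha>) * k\<close>, so the factor
  \<open>q ^ (n - m)\<close> falls below any \<open>e\<close>.\<close>

lemma geometric_decay_ratio:
  fixes g :: "nat \<Rightarrow> real"
  assumes q: "0 < q" "q < 1" and gpos: "\<And>k. k \<ge> 1 \<Longrightarrow> 0 < g k"
    and decay: "\<And>m n. 1 \<le> m \<Longrightarrow> m \<le> n \<Longrightarrow> g n \<le> q ^ (n - m) * g m"
    and ab: "0 < \<alpha>" "\<alpha> < \<beta>" and e: "0 < e"
  shows "\<forall>\<^sub>F k in sequentially. g (nat \<lceil>\<beta> * real k\<rceil>) < e * g (nat \<lceil>\<alpha> * real k\<rceil>)"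
proof -
  have "(\<lambda>n. q ^ n) \<longlonglongrightarrow> 0" using q by (intro LIMSEQ_realpow_zero) auto
  then have "\<forall>\<^sub>F n in sequentially. q ^ n < e" using e by (rule order_tendstoD)
  then obtain n0 where n0: "\<And>n. n \<ge> n0 \<Longrightarrow> q ^ n < e" by (auto simp: eventually_sequentially)
  \<comment> \<open>The \<open>+ 1\<close> next to \<open>n0\<close> pays for rounding up
    \<open>\<alpha> * k\<close>.\<close>
  define K where "K = nat \<lceil>(real n0 + 1) / (\<beta> - \<alpha>)\<rceil> + 1"
  have "g (nat \<lceil>\<beta> * real k\<rceil>) < e * g (nat \<lceil>\<alpha> * real k\<rceil>)" if "k \<ge> K" for k
  proof -
    have "(real n0 + 1) / (\<beta> - \<alpha>) \<le> real k" "0 < real k" using that unfolding K_def by linarith+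
    then have *: "real n0 + 1 \<le> \<beta> * real k - \<alpha> * real k" "0 < \<alpha> * real k"
      using ab by (auto simp: field_simps)
    define m n where "m = nat \<lceil>\<alpha> * real k\<rceil>" and "n = nat \<lceil>\<beta> * real k\<rceil>"
    have mn: "1 \<le> m" "m \<le> n" "n - m \<ge> n0" using * unfolding m_def n_def by linarith+
    have "g n \<le> q ^ (n - m) * g m" by (rule decay) (use mn in auto)
    also have "\<dots> < e * g m" using n0 mn gpos[of m] by (intro mult_strict_right_mono) auto
    finally show ?thesis by (simp add: m_def n_def)
  qed
  then show ?thesis by (auto simp: eventually_sequentially)
qed

text \<open>Monotonicity on \<open>[n, n + 1]\<close> puts \<open>\<Psi> z\<close> between its
  values at the endpoints. Since \<open>g\<close> decreases, rounding up in the upper bound and down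
  in the lower bound both err on the safe side. So \<open>\<Psi>\<close> is comparable to
  \<open>1 / g\<close> at real arguments too.\<close>

lemma unit_monotone_sandwich:
  fixes \<Psi> :: "real \<Rightarrow> real" and g :: "nat \<Rightarrow> real"
  assumes pos: "\<And>x. 0 < x \<Longrightarrow> 0 < \<Psi> x"
    and gpos: "\<And>k. k \<ge> 1 \<Longrightarrow> 0 < g k" and gmono: "\<And>m n. 1 \<le> m \<Longrightarrow> m \<le> n \<Longrightarrow> g n \<le> g m"
    and bnd: "\<And>k. k \<ge> 1 \<Longrightarrow> 1 \<le> \<Psi> (real k) * g k" "\<And>k. k \<ge> 1 \<Longrightarrow> \<Psi> (real k) * g k \<le> C"
    and mono: "\<And>n::nat. mono_on ({real n..real n + 1} \<inter> {0<..}) \<Psi> \<or>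
                  monotone_on ({real n..real n + 1} \<inter> {0<..}) (\<le>) (\<ge>) \<Psi>"
    and z: "1 \<le> z"
  shows "\<Psi> z * g (nat \<lceil>z\<rceil>) \<le> C" and "1 \<le> \<Psi> z * g (nat \<lfloor>z\<rfloor>)"
proof -
  define n where "n = nat \<lfloor>z\<rfloor>"
  have n: "1 \<le> n" "real n \<le> z" "z < real n + 1" using z unfolding n_def by linarith+
  have z0: "0 < z" using z by simp
  have "(\<Psi> (real n) \<le> \<Psi> z \<and> \<Psi> z \<le> \<Psi> (real n + 1)) \<or> (\<Psi> (real n + 1) \<le> \<Psi> z \<and> \<Psi> z \<le> \<Psi> (real n))"
    using mono[of n] n by (auto simp: monotone_on_def)
  then have between: "\<Psi> z \<le> max (\<Psi> (real n)) (\<Psi> (real n + 1))" "min (\<Psi> (real n)) (\<Psi> (real n + 1)) \<le> \<Psi> z"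
    by auto
  have b1: "1 \<le> \<Psi> (real n) * g n" "\<Psi> (real n) * g n \<le> C" using bnd n by auto
  have b2: "1 \<le> \<Psi> (real n + 1) * g (Suc n)" "\<Psi> (real n + 1) * g (Suc n) \<le> C"
    using bnd[of "Suc n"] by (simp_all add: add.commute)
  have gs: "0 < g (Suc n)" "g (Suc n) \<le> g n" "0 < g n" using gpos gmono n by auto
  have P: "0 < \<Psi> (real n)" "0 < \<Psi> (real n + 1)" using pos n by auto
  have "\<Psi> (real n) * g (Suc n) \<le> C" using b1 gs P mult_left_mono[of "g (Suc n)" "g n" "\<Psi> (real n)"] by linarith
  moreover have "\<Psi> z * g (Suc n) \<le> max (\<Psi> (real n)) (\<Psi> (real n + 1)) * g (Suc n)"
    using between gs by (intro mult_right_mono) auto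
  ultimately have up: "\<Psi> z * g (Suc n) \<le> C" using b2 by (auto simp: max_def split: if_splits)
  show "\<Psi> z * g (nat \<lceil>z\<rceil>) \<le> C"
  proof (cases "z = real n")
    case True then show ?thesis using b1 by simp
  next
    case False
    then have "nat \<lceil>z\<rceil> = Suc n" using n by linarith
    then show ?thesis using up by simp
  qed
  have "1 \<le> \<Psi> (real n + 1) * g n" using b2 gs P mult_left_mono[of "g (Suc n)" "g n" "\<Psi> (real n + 1)"] by linarith
  moreover have "min (\<Psi> (real n)) (\<Psi> (real n + 1)) * g n \<le> \<Psi> z * g n"
    using between gs by (intro mult_right_mono) auto
  ultimately show "1 \<le> \<Psi> z * g (nat \<lfloor>z\<rfloor>)"
    using b1 unfolding n_def[symmetric] by (auto simp: min_def split: if_splits)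
qed

text \<open>Fix the pairs \<open>(p + t, r - t)\<close> on a segment of the simplex, with slopes \<open>(r - t) / (p + t)\<close>. The
  parameters \<open>t\<close> for which \<open>(p + t) N = k\<close> for some \<open>N\<close> become dense as \<open>k\<close> grows, even along a sparse sequence of \<open>k\<close>,
  and a fixed gap between two slopes is amplified by the geometric decay of \<open>g\<close> to an unbounded factor. By Baire,
  oscillation of \<open>\<Phi>(k)\<close> between the two slopes \<open>t1\<close>, \<open>t2\<close> forces a single \<open>t\<close> whose ratio oscillates
  between \<open>0\<close> and \<open>\<infinity>\<close>.\<close>

lemma oscillation_between_slopes:
  fixes \<Phi> \<Psi> :: "real \<Rightarrow> real" and g :: "nat \<Rightarrow> real"
  assumes q: "0 < q" "q < 1" and gpos: "\<And>k. k \<ge> 1 \<Longrightarrow> 0 < g k"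
    and decay: "\<And>m n. 1 \<le> m \<Longrightarrow> m \<le> n \<Longrightarrow> g n \<le> q ^ (n - m) * g m"
    and gmono: "\<And>m n. 1 \<le> m \<Longrightarrow> m \<le> n \<Longrightarrow> g n \<le> g m"
    and pos: "\<And>x. 0 < x \<Longrightarrow> 0 < \<Phi> x" "\<And>x. 0 < x \<Longrightarrow> 0 < \<Psi> x"
    and cont: "continuous_on {0<..} \<Phi>" "continuous_on {0<..} \<Psi>"
    and up: "\<And>z. 1 \<le> z \<Longrightarrow> \<Psi> z * g (nat \<lceil>z\<rceil>) \<le> C"
    and lo: "\<And>z. 1 \<le> z \<Longrightarrow> 1 \<le> \<Psi> z * g (nat \<lfloor>z\<rfloor>)"
    and t: "0 < p" "0 \<le> t1" "t1 < t2" "t2 < r"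
    and c: "0 < c"
    and U: "\<exists>\<^sub>F k in sequentially. c \<le> \<Phi> (real k) * g (nat \<lceil>(r - t1) / (p + t1) * real k\<rceil>)"
    and L: "\<exists>\<^sub>F k in sequentially. \<Phi> (real k) * g (nat \<lceil>(r - t2) / (p + t2) * real k\<rceil>) \<le> 1"
  shows "\<exists>t. t1 < t \<and> t < t2 \<and>
    liminf (\<lambda>N. ereal (\<Phi> ((p + t) * real N) / \<Psi> ((r - t) * real N))) = 0 \<and>
    limsup (\<lambda>N. ereal (\<Phi> ((p + t) * real N) / \<Psi> ((r - t) * real N))) = \<infinity>"
proof -
  define s where "s = (\<lambda>t. (r - t) / (p + t))"
  have s_pos: "0 < s x" if "0 \<le> x" "x < r" for x using that t by (simp add: s_def)
  have s_less: "s y < s x" if "0 \<le> x" "x < y" "y < r" for x y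
    unfolding s_def using that t by (intro frac_less2) auto
  define \<rho> where "\<rho> = (\<lambda>N t. \<Phi> ((p + t) * real N) / \<Psi> ((r - t) * real N))"
  \<comment> \<open>The middle third keeps a fixed distance from \<open>t1\<close> and
    \<open>t2\<close>, so every slope over \<open>{a..b}\<close> lies strictly between
    \<open>s t2\<close> and \<open>s t1\<close>.\<close>
  define a b where "a = (2 * t1 + t2) / 3" and "b = (t1 + 2 * t2) / 3"
  have ab: "t1 < a" "a < b" "b < t2" "0 \<le> a" "b < r" using t by (auto simp: a_def b_def)
  have C: "0 < C"
  proof -
    have "0 < \<Psi> 1 * g 1" using pos(2)[of 1] gpos[of 1] by simp
    also have "\<dots> \<le> C" using up[of 1] by simp
    finally show ?thesis .
  qed
  have "\<exists>t\<in>{a..b}. \<forall>M\<ge>1. (\<exists>N\<ge>M. \<rho> N t > real M) \<and> (\<exists>N\<ge>M. \<rho> N t < 1 / real M)"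
  proof (rule Baire_oscillation[OF ab(2)])
    fix N :: nat assume "N \<ge> 1"
    then have pos': "0 < (p + t) * real N" "0 < (r - t) * real N" if "t \<in> {a..b}" for t
      using that ab t by auto
    show "continuous_on {a..b} (\<rho> N)"
      unfolding \<rho>_def
    proof (intro continuous_on_divide ballI)
      show "continuous_on {a..b} (\<lambda>t. \<Phi> ((p + t) * real N))"
        by (rule continuous_on_compose2[OF cont(1)]) (use pos' in \<open>auto intro!: continuous_intros\<close>)
      show "continuous_on {a..b} (\<lambda>t. \<Psi> ((r - t) * real N))"
        by (rule continuous_on_compose2[OF cont(2)]) (use pos' in \<open>auto intro!: continuous_intros\<close>)
      show "\<Psi> ((r - t) * real N) \<noteq> 0" if "t \<in> {a..b}" for t
        using pos(2)[OF pos'(2)[OF that]] by simp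
    qed
  next
    fix M :: nat and x y assume M: "1 \<le> M" and xy: "a \<le> x" "x < y" "y \<le> b"
    \<comment> \<open>Chosen so that \<open>e * C = c / M\<close>, which turns the lower bound
      \<open>c\<close> into a ratio above \<open>M\<close>.\<close>
    define e where "e = c / (C * real M)"
    have e: "0 < e" using c C M by (simp add: e_def)
    have ss: "0 < s y" "0 < s x" "s x < s t1" using s_pos s_less xy ab t by auto
    have grid: "\<forall>\<^sub>F k in sequentially. \<exists>N\<ge>M. \<exists>t. x < t \<and> t < y \<and> (p + t) * real N = real k"
      using xy ab t by (intro eventually_grid_point) auto
    have large: "\<forall>\<^sub>F k in sequentially. 1 / s y \<le> real k"
      by (rule eventually_sequentiallyI[of "nat \<lceil>1 / s y\<rceil>"]) linarith
    \<comment> \<open>\<open>U\<close> holds for infinitely many \<open>k\<close> and the other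
      conditions for all large \<open>k\<close>. The grid condition makes \<open>(p + t) * N\<close>
      the integer \<open>k\<close> itself, so \<open>U\<close> speaks about the numerator of
      \<open>\<rho> N t\<close>.\<close>
    obtain k where k: "c \<le> \<Phi> (real k) * g (nat \<lceil>s t1 * real k\<rceil>)"
      "\<exists>N\<ge>M. \<exists>t. x < t \<and> t < y \<and> (p + t) * real N = real k" "1 / s y \<le> real k"
      "g (nat \<lceil>s t1 * real k\<rceil>) < e * g (nat \<lceil>s x * real k\<rceil>)"
      using frequently_ex[OF frequently_eventually_frequently[OF U eventually_conj[OF grid
            eventually_conj[OF large geometric_decay_ratio[OF q gpos decay ss(2,3) e]]]]]
      by (auto simp: s_def)
    then obtain N t where N: "N \<ge> M" "x < t" "t < y" "(p + t) * real N = real k" by blast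
    define z where "z = (r - t) * real N"
    have pt: "0 < p + t" "0 \<le> t" "t < r" using N xy ab t by auto
    have z: "z = s t * real k" using N(4)[symmetric] pt by (simp add: z_def s_def)
    have st: "s y < s t" "s t < s x" using s_less N xy ab by auto
    have "0 < 1 / s y" using ss by simp
    then have k0: "1 \<le> s y * real k" "0 < real k" using k(3) ss by (simp add: field_simps, linarith)
    have z1: "1 \<le> z" using k0 mult_strict_right_mono[OF st(1) k0(2)] unfolding z by linarith
    have "z \<le> s x * real k" using st k0 by (simp add: z)
    then have "g (nat \<lceil>s x * real k\<rceil>) \<le> g (nat \<lceil>z\<rceil>)"
      using z1 by (intro gmono) linarith+
    with k(4) e have "g (nat \<lceil>s t1 * real k\<rceil>) < e * g (nat \<lceil>z\<rceil>)"
      by (meson less_le_trans mult_left_mono less_imp_le)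
    then have "\<Phi> (real k) * g (nat \<lceil>s t1 * real k\<rceil>) < \<Phi> (real k) * (e * g (nat \<lceil>z\<rceil>))"
      using pos(1) k0 by simp
    with k(1) have *: "c < \<Phi> (real k) * (e * g (nat \<lceil>z\<rceil>))" by simp
    have Pz: "0 < \<Psi> z" using pos z1 by simp
    have gz: "g (nat \<lceil>z\<rceil>) \<le> C / \<Psi> z" using up[OF z1] Pz by (simp add: field_simps)
    have "\<Phi> (real k) * (e * g (nat \<lceil>z\<rceil>)) \<le> \<Phi> (real k) * (e * (C / \<Psi> z))"
      using gz e pos(1)[OF k0(2)] by (intro mult_left_mono) auto
    also have "\<dots> = \<Phi> (real k) / \<Psi> z * (c / real M)" using C by (simp add: e_def)
    finally have "c < \<Phi> (real k) / \<Psi> z * (c / real M)" using * by simp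
    then have "c * real M < \<Phi> (real k) / \<Psi> z * (c / real M) * real M"
      using M by (intro mult_strict_right_mono) auto
    also have "\<dots> = c * (\<Phi> (real k) / \<Psi> z)" using M by simp
    finally have "real M < \<Phi> (real k) / \<Psi> z"
      using c by (simp only: mult_less_cancel_left_pos)
    then show "\<exists>N\<ge>M. \<exists>t\<in>{x<..<y}. real M < \<rho> N t"
      using N by (intro exI[of _ N] conjI bexI[of _ t]) (auto simp: \<rho>_def z_def)
  next
    fix M :: nat and x y assume M: "1 \<le> M" and xy: "a \<le> x" "x < y" "y \<le> b"
    define e where "e = 1 / real M"
    have e: "0 < e" using M by (simp add: e_def)
    \<comment> \<open>The gap from \<open>s t2\<close> to \<open>\<beta>\<close> yields the
      geometric factor; the gap from \<open>\<beta>\<close> to \<open>s y\<close> gives two units of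
      room for comparing \<open>\<lfloor>z\<rfloor>\<close> with
      \<open>\<lceil>\<beta> * k\<rceil>\<close>.\<close>
    define \<beta> where "\<beta> = (s t2 + s y) / 2"
    have ss: "0 < s t2" "s t2 < s y" using s_pos s_less xy ab t by auto
    then have \<beta>: "s t2 < \<beta>" "\<beta> < s y" "0 < \<beta>" by (auto simp: \<beta>_def)
    have grid: "\<forall>\<^sub>F k in sequentially. \<exists>N\<ge>M. \<exists>t. x < t \<and> t < y \<and> (p + t) * real N = real k"
      using xy ab t by (intro eventually_grid_point) auto
    have large: "\<forall>\<^sub>F k in sequentially. 2 / (s y - \<beta>) \<le> real k"
      by (rule eventually_sequentiallyI[of "nat \<lceil>2 / (s y - \<beta>)\<rceil>"]) linarith
    obtain k where k: "\<Phi> (real k) * g (nat \<lceil>s t2 * real k\<rceil>) \<le> 1"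
      "\<exists>N\<ge>M. \<exists>t. x < t \<and> t < y \<and> (p + t) * real N = real k" "2 / (s y - \<beta>) \<le> real k"
      "g (nat \<lceil>\<beta> * real k\<rceil>) < e * g (nat \<lceil>s t2 * real k\<rceil>)"
      using frequently_ex[OF frequently_eventually_frequently[OF L eventually_conj[OF grid
            eventually_conj[OF large geometric_decay_ratio[OF q gpos decay ss(1) \<beta>(1) e]]]]]
      by (auto simp: s_def)
    then obtain N t where N: "N \<ge> M" "x < t" "t < y" "(p + t) * real N = real k" by blast
    define z where "z = (r - t) * real N"
    have pt: "0 < p + t" "0 \<le> t" "t < r" using N xy ab t by auto
    have z: "z = s t * real k" using N(4)[symmetric] pt by (simp add: z_def s_def)
    have st: "s y < s t" using s_less N xy ab by auto
    have k0: "0 < real k" using \<beta> by (intro less_le_trans[OF _ k(3)]) simp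
    have k2: "\<beta> * real k + 2 \<le> s y * real k" using k(3) \<beta> by (simp add: field_simps)
    have \<beta>k: "0 < \<beta> * real k" using \<beta> k0 by simp
    have zy: "s y * real k \<le> z" using st k0 by (simp add: z)
    have z1: "1 \<le> z" using k2 zy \<beta>k by linarith
    have "g (nat \<lfloor>z\<rfloor>) \<le> g (nat \<lceil>\<beta> * real k\<rceil>)"
      using k2 zy \<beta>k by (intro gmono) linarith+
    with k(4) have "g (nat \<lfloor>z\<rfloor>) < e * g (nat \<lceil>s t2 * real k\<rceil>)" by simp
    then have "\<Psi> z * g (nat \<lfloor>z\<rfloor>) < \<Psi> z * (e * g (nat \<lceil>s t2 * real k\<rceil>))"
      using pos(2) z1 by simp
    with lo[OF z1] have *: "1 < \<Psi> z * (e * g (nat \<lceil>s t2 * real k\<rceil>))" by simp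
    have Pz: "0 < \<Psi> z" and Pk: "0 < \<Phi> (real k)" using pos z1 k0 by simp_all
    have "\<Phi> (real k) < \<Phi> (real k) * (\<Psi> z * (e * g (nat \<lceil>s t2 * real k\<rceil>)))"
      using mult_strict_left_mono[OF * Pk] by simp
    also have "\<dots> = (\<Psi> z * e) * (\<Phi> (real k) * g (nat \<lceil>s t2 * real k\<rceil>))" by simp
    also have "\<dots> \<le> \<Psi> z * e" using k(1) Pz e by (intro mult_left_le) auto
    finally have "\<Phi> (real k) / \<Psi> z < 1 / real M" using Pz by (simp add: e_def field_simps)
    then show "\<exists>N\<ge>M. \<exists>t\<in>{x<..<y}. \<rho> N t < 1 / real M"
      using N by (intro exI[of _ N] conjI bexI[of _ t]) (auto simp: \<rho>_def z_def)
  qed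
  then obtain t where tt: "t \<in> {a..b}"
    and osc: "\<forall>M\<ge>1. (\<exists>N\<ge>M. \<rho> N t > real M) \<and> (\<exists>N\<ge>M. \<rho> N t < 1 / real M)" by blast
  have "liminf (\<lambda>N. ereal (\<rho> N t)) = 0 \<and> limsup (\<lambda>N. ereal (\<rho> N t)) = \<infinity>"
  proof (rule liminf_0_limsup_infinity)
    fix N :: nat assume "N \<ge> 1"
    then have "0 < (p + t) * real N" "0 < (r - t) * real N" using tt ab t by auto
    then show "0 \<le> \<rho> N t" using pos by (simp add: \<rho>_def less_imp_le)
  qed (rule osc)
  then show ?thesis using tt ab by (intro exI[of _ t]) (auto simp: \<rho>_def)
qed

section \<open>Comparison of feedback functions\<close>

lemma init_config_pos:
  assumes "0 < chi l" "N \<ge> 1"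
  shows "1 \<le> init_config chi N l"
proof -
  have "0 < chi l * real N" using assms by simp
  then show ?thesis unfolding init_config_def by linarith
qed

text \<open>The \<open>+ 1\<close> absorbs the rounding up in the initial configuration.\<close>

lemma tail_small_at_steeper_slope:
  fixes \<Phi> :: "real \<Rightarrow> real" and g :: "nat \<Rightarrow> real"
  assumes q: "0 < q" "q < 1" and gpos: "\<And>k. k \<ge> 1 \<Longrightarrow> 0 < g k"
    and decay: "\<And>m n. 1 \<le> m \<Longrightarrow> m \<le> n \<Longrightarrow> g n \<le> q ^ (n - m) * g m"
    and pos: "\<And>x. 0 < x \<Longrightarrow> 0 < \<Phi> x"
    and st: "0 < \<sigma>" "\<sigma> < \<tau>" and e: "0 < e"
    and ev: "\<forall>\<^sub>F k in sequentially. 1 < \<Phi> (real k) * g (nat \<lceil>\<tau> * real k\<rceil>)"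
  shows "\<forall>\<^sub>F k in sequentially. summable (\<lambda>l. 1 / \<Phi> (real (l + k))) \<and>
    (\<forall>m. 1 \<le> m \<and> real m \<le> \<sigma> * real k + 1 \<longrightarrow> (\<Sum>l. 1 / \<Phi> (real (l + k))) \<le> e * g m)"
proof -
  \<comment> \<open>The index gap from \<open>m\<close> to
    \<open>\<lceil>\<tau> * (l + k)\<rceil>\<close> is at least
    \<open>\<tau> * l + (\<tau> - \<sigma>) * k - 1\<close>. Thus \<open>Q\<close> gives a geometric
    series in \<open>l\<close>, \<open>R ^ k\<close> makes it small, and a factor
    \<open>1 / q\<close> pays for the \<open>- 1\<close>.\<close>
  define Q where "Q = q powr \<tau>"
  define R where "R = q powr (\<tau> - \<sigma>)"
  have QR: "0 < Q" "Q < 1" "0 < R" "R < 1"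
    using q st by (auto simp: Q_def R_def powr01_less_one)
  have pw: "(q powr a) ^ n = q powr (a * real n)" for a n
    using q by (simp add: powr_realpow[symmetric] powr_powr)
  have "(\<lambda>k. R ^ k / q / (1 - Q)) \<longlonglongrightarrow> 0 / q / (1 - Q)"
    using QR q by (intro tendsto_divide LIMSEQ_realpow_zero tendsto_const) auto
  then have small: "\<forall>\<^sub>F k in sequentially. R ^ k / q / (1 - Q) < e"
    using e by (intro order_tendstoD) auto
  obtain K where K: "\<And>k. k \<ge> K \<Longrightarrow> 1 < \<Phi> (real k) * g (nat \<lceil>\<tau> * real k\<rceil>)"
    using ev by (auto simp: eventually_sequentially)
  have bound: "1 / \<Phi> (real (l + k)) \<le> R ^ k / q * g m * Q ^ l"
    if k: "k \<ge> K" "k \<ge> 1" and m: "1 \<le> m" "real m \<le> \<sigma> * real k + 1"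
      and large: "1 \<le> (\<tau> - \<sigma>) * real k" for k l m
  proof -
    define n where "n = nat \<lceil>\<tau> * real (l + k)\<rceil>"
    have n: "\<tau> * real l + \<tau> * real k \<le> real n" unfolding n_def by (simp add: algebra_simps) linarith
    have "0 \<le> \<tau> * real l" using st by simp
    then have mn: "m \<le> n" using n m large by (simp add: algebra_simps)
    have "1 / \<Phi> (real (l + k)) \<le> g n"
      using K[of "l + k"] k pos[of "real (l + k)"] by (simp add: n_def field_simps)
    also have "\<dots> \<le> q ^ (n - m) * g m" using decay m mn by simp
    also have "q ^ (n - m) = q powr (real n - real m)"
      using q mn by (simp add: powr_realpow[symmetric])
    also have "\<dots> \<le> q powr (\<tau> * real l + (\<tau> - \<sigma>) * real k - 1)"
      using q n m by (intro powr_mono') (auto simp: algebra_simps)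
    also have "\<dots> = R ^ k / q * Q ^ l"
    proof -
      have "q powr (\<tau> * real l + (\<tau> - \<sigma>) * real k - 1)
          = q powr (\<tau> * real l) * q powr ((\<tau> - \<sigma>) * real k) / q powr 1"
        by (simp only: powr_add powr_diff)
      then show ?thesis
        unfolding R_def Q_def pw using q by simp
    qed
    finally show ?thesis using gpos[OF m(1)] by (simp add: mult_right_mono mult.assoc mult.commute[of "g m"])
  qed
  have "\<forall>\<^sub>F k in sequentially. 1 / (\<tau> - \<sigma>) \<le> real k"
    by (rule eventually_sequentiallyI[of "nat \<lceil>1 / (\<tau> - \<sigma>)\<rceil>"]) linarith
  moreover have "\<forall>\<^sub>F k in sequentially. max K (max 1 (nat \<lceil>1 / \<sigma>\<rceil>)) \<le> k" by (rule eventually_ge_at_top)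
  ultimately show ?thesis using small
  proof eventually_elim
    case (elim k)
    have k: "k \<ge> K" "k \<ge> 1" "1 / \<sigma> \<le> real k" using elim(2) by linarith+
    have large: "1 \<le> (\<tau> - \<sigma>) * real k" using elim(1) st by (simp add: field_simps)
    \<comment> \<open>\<open>m = 1\<close> is always admissible and supplies the convergent majorant
      for summability.\<close>
    have one: "real 1 \<le> \<sigma> * real k + 1" using st by simp
    have geo: "summable (\<lambda>l. R ^ k / q * g m * Q ^ l)" for m
      using QR by (intro summable_mult summable_geometric) auto
    have nonneg: "0 \<le> 1 / \<Phi> (real (l + k))" for l
      using pos[of "real (l + k)"] k by simp
    have sm: "summable (\<lambda>l. 1 / \<Phi> (real (l + k)))"
      by (rule summable_comparison_test'[OF geo[of 1], of 0])
        (use bound[OF k(1,2) order.refl one large] nonneg in auto)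
    have "(\<Sum>l. 1 / \<Phi> (real (l + k))) \<le> e * g m" if m: "1 \<le> m" "real m \<le> \<sigma> * real k + 1" for m
    proof -
      have "(\<Sum>l. 1 / \<Phi> (real (l + k))) \<le> (\<Sum>l. R ^ k / q * g m * Q ^ l)"
        using bound[OF k(1,2) m large] sm geo by (intro suminf_le) auto
      also have "\<dots> = R ^ k / q * g m * (1 / (1 - Q))"
        using QR by (subst suminf_mult) (auto simp: suminf_geometric)
      also have "\<dots> = R ^ k / q / (1 - Q) * g m" by simp
      also have "\<dots> \<le> e * g m" using elim(3) gpos[OF m(1)] by (intro mult_right_mono) auto
      finally show ?thesis .
    qed
    with sm show ?case by blast
  qed
qed

section \<open>Moving mass from one agent to another\<close>

lemma open_simplex_shift:
  assumes chi: "chi \<in> open_simplex A" and ij: "i \<in> agents A" "j \<in> agents A" "i \<noteq> j"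
    and t: "0 \<le> t" "t < chi i"
  shows "chi(i := chi i - t, j := chi j + t) \<in> open_simplex A"
proof -
  let ?y = "chi(i := chi i - t, j := chi j + t)"
  have "(\<Sum>l\<in>agents A. ?y l)
      = (\<Sum>l\<in>agents A. chi l + ((if l = j then t else 0) - (if l = i then t else 0)))"
    using ij by (intro sum.cong) auto
  also have "\<dots> = 1" using chi ij by (simp add: sum.distrib sum_subtractf open_simplex_def)
  finally show ?thesis using chi ij t by (auto simp: open_simplex_def add_pos_nonneg)
qed

text \<open>The shift is continuous in \<open>t\<close> in each coordinate, hence in the product
  topology, so it stays in a neighbourhood of \<open>chi\<close> for small \<open>t\<close>. The cap
  \<open>chi i / 2\<close> keeps coordinate \<open>i\<close> positive.\<close>

lemma interior_D_set_shift:
  assumes chi: "chi \<in> (top_of_set (open_simplex A)) interior_of (D_set A F i)"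
    and ij: "i \<in> agents A" "j \<in> agents A" "i \<noteq> j"
  obtains \<delta> where "0 < \<delta>" "\<delta> < chi i"
    "\<And>t. 0 \<le> t \<Longrightarrow> t < \<delta> \<Longrightarrow> chi(i := chi i - t, j := chi j + t) \<in> D_set A F i"
proof -
  let ?y = "\<lambda>t. chi(i := chi i - t, j := chi j + t)"
  obtain T where T: "openin (top_of_set (open_simplex A)) T" "chi \<in> T" "T \<subseteq> D_set A F i"
    using chi by (auto simp: interior_of_def)
  then obtain W where W: "open W" "T = open_simplex A \<inter> W" by (auto simp: openin_open)
  have chi_in: "chi \<in> open_simplex A" using T W by blast
  then have chi_i: "0 < chi i" using ij by (simp add: open_simplex_def)
  have "continuous_on UNIV ?y"
  proof (rule continuous_on_coordinatewise_then_product)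
    show "continuous_on UNIV (\<lambda>t. ?y t l)" for l
      by (cases "l = j"; cases "l = i") (auto intro!: continuous_intros)
  qed
  then have "open (?y -` W)" using W(1) by (rule open_vimage[rotated])
  moreover have "?y 0 = chi" by auto
  then have "0 \<in> ?y -` W" using T W by simp
  ultimately obtain d where d: "0 < d" "\<And>t. dist t 0 < d \<Longrightarrow> ?y t \<in> W"
    unfolding open_dist by blast
  define \<delta> where "\<delta> = min d (chi i / 2)"
  show thesis
  proof (rule that[of \<delta>])
    show "0 < \<delta>" "\<delta> < chi i" using d chi_i by (auto simp: \<delta>_def)
    fix t assume t: "0 \<le> t" "t < \<delta>"
    then have "?y t \<in> W" using d by (auto simp: \<delta>_def)
    moreover have "?y t \<in> open_simplex A"
      using t chi_i by (intro open_simplex_shift[OF chi_in ij]) (auto simp: \<delta>_def)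
    ultimately show "?y t \<in> D_set A F i" using T W by blast
  qed
qed

lemma feedback_ratio_tendsto_0:
  assumes F: "admissible_feedback A F"
    and osc: "\<forall>x\<in>open_simplex A. \<forall>k\<in>agents A. \<forall>l\<in>agents A.
           \<not> (liminf (\<lambda>N. ereal (F k (x k * real N) / F l (x l * real N))) = 0 \<and>
              limsup (\<lambda>N. ereal (F k (x k * real N) / F l (x l * real N))) = \<infinity>)"
    and i: "i \<in> agents A" "type_E F i"
    and chi: "chi \<in> (top_of_set (open_simplex A)) interior_of (D_set A F i)"
    and j: "j \<in> agents A" "j \<noteq> i"
  shows "(\<lambda>N. F j (real (init_config chi N j)) / F i (real (init_config chi N i))) \<longlonglongrightarrow> 0"
proof (rule ccontr)
  assume not_lim: "\<not> ?thesis"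
  have ij: "i \<noteq> j" using j by simp
  have Fpos: "0 < F l x" if "l \<in> agents A" "0 < x" for l x
    using F that by (auto simp: admissible_feedback_def)
  have Fcont: "continuous_on {0<..} (F l)" if "l \<in> agents A" for l
    using F that by (auto simp: admissible_feedback_def intro: C1_differentiable_imp_continuous_on)
  have Fmono: "mono_on ({real n..real n + 1} \<inter> {0<..}) (F i) \<or>
      monotone_on ({real n..real n + 1} \<inter> {0<..}) (\<le>) (\<ge>) (F i)" for n :: nat
    using F i by (auto simp: admissible_feedback_def)
  have M: "cond_M F i" using i by (simp add: type_E_def)
  define g where "g = tail_sum F i"
  have gpos: "0 < g k" if "k \<ge> 1" for k
    unfolding g_def by (rule tail_sum_pos[OF M _ that]) (use Fpos i in auto)
  obtain C q where C: "0 < C" and q: "0 < q" "q < 1"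
    and gC: "\<And>k. k \<ge> 1 \<Longrightarrow> F i (real k) * g k \<le> C"
    and decay: "\<And>m n. 1 \<le> m \<Longrightarrow> m \<le> n \<Longrightarrow> g n \<le> q ^ (n - m) * g m"
    using type_E_decay[OF i(2)] Fpos i(1) unfolding g_def by metis
  \<comment> \<open>The leading term of the tail alone contributes \<open>1\<close>; with
    \<open>gC\<close> this makes \<open>F i\<close> and \<open>1 / g\<close> agree up to the factor
    \<open>C\<close> at integers.\<close>
  have g1: "1 \<le> F i (real k) * g k" if "k \<ge> 1" for k
    using tail_sum_Suc(1)[OF M that] gpos[of "Suc k"] Fpos[OF i(1), of "real k"] that
    by (simp add: g_def field_simps)
  have gmono: "g n \<le> g m" if "1 \<le> m" "m \<le> n" for m n
  proof -
    have "q ^ (n - m) * g m \<le> 1 * g m"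
      using q gpos[OF that(1)] by (intro mult_right_mono power_le_one) auto
    then show ?thesis using decay[OF that] by simp
  qed
  note sandwich = unit_monotone_sandwich[of "F i" g C, OF Fpos[OF i(1)] gpos gmono g1 gC Fmono]
  obtain \<delta> where \<delta>: "0 < \<delta>" "\<delta> < chi i"
    and D: "\<And>t. 0 \<le> t \<Longrightarrow> t < \<delta> \<Longrightarrow> chi(i := chi i - t, j := chi j + t) \<in> D_set A F i"
    using interior_D_set_shift[OF chi i(1) j(1) ij] by blast
  have simplex: "chi(i := chi i - t, j := chi j + t) \<in> open_simplex A" if "0 \<le> t" "t < \<delta>" for t
    using D[OF that] by (simp add: D_set_def)
  define p r where "p = chi j" and "r = chi i"
  have pr: "0 < p" "0 < r" using simplex[of 0] \<delta> i j by (auto simp: open_simplex_def p_def r_def)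
  define s where "s = (\<lambda>t. (r - t) / (p + t))"
  have s_pos: "0 < s x" if "0 \<le> x" "x < r" for x using that pr by (simp add: s_def)
  have s_less: "s y < s x" if "0 \<le> x" "x < y" "y < r" for x y
    unfolding s_def using that pr by (intro frac_less2) auto
  \<comment> \<open>The slopes at \<open>t1\<close> and \<open>t2\<close> delimit the oscillation;
    \<open>t3\<close> gives the still lower slope at which \<open>i\<close> loses against
    \<open>j\<close>.\<close>
  define t1 t2 t3 where "t1 = \<delta> / 4" and "t2 = \<delta> / 2" and "t3 = 3 * \<delta> / 4"
  have t: "0 < t1" "t1 < t2" "t2 < t3" "t3 < \<delta>" "t3 < r"
    using \<delta> by (auto simp: t1_def t2_def t3_def r_def)
  define a where "a = init_config chi"
  have a_pos: "1 \<le> a N i" "1 \<le> a N j" if "N \<ge> 1" for N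
    using pr that init_config_pos[of chi _ N] unfolding a_def p_def r_def by auto
  have a_ge: "r * real N \<le> real (a N i)" "p * real N \<le> real (a N j)" "real (a N j) \<le> p * real N + 1" for N
  proof -
    have "0 \<le> p * real N" "0 \<le> r * real N" using pr by auto
    then show "r * real N \<le> real (a N i)" "p * real N \<le> real (a N j)" "real (a N j) \<le> p * real N + 1"
      unfolding a_def init_config_def p_def r_def by linarith+
  qed
  obtain e where e: "0 < e" and freq: "\<exists>\<^sub>F N in sequentially. e \<le> F j (real (a N j)) / F i (real (a N i))"
  proof -
    obtain e where "0 < e"
      "\<not> (\<forall>\<^sub>F N in sequentially. dist (F j (real (a N j)) / F i (real (a N i))) 0 < e)"
      using not_lim unfolding tendsto_iff a_def by blast
    then have "\<exists>\<^sub>F N in sequentially. \<not> dist (F j (real (a N j)) / F i (real (a N i))) 0 < e"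
      by (simp add: not_eventually)
    then have "\<exists>\<^sub>F N in sequentially. e \<le> F j (real (a N j)) / F i (real (a N i))"
    proof (rule frequently_rev_mp)
      show "\<forall>\<^sub>F N in sequentially. \<not> dist (F j (real (a N j)) / F i (real (a N i))) 0 < e \<longrightarrow>
          e \<le> F j (real (a N j)) / F i (real (a N i))"
        using eventually_ge_at_top[of 1]
      proof eventually_elim
        case (elim N)
        then have "0 < F j (real (a N j)) / F i (real (a N i))"
          using a_pos[OF elim] Fpos i j by (intro divide_pos_pos) auto
        then show ?case unfolding dist_real_def by linarith
      qed
    qed
    with \<open>0 < e\<close> show thesis by (rule that)
  qed
  have U: "\<exists>\<^sub>F k in sequentially. e \<le> F j (real k) * g (nat \<lceil>s t1 * real k\<rceil>)"
    unfolding frequently_sequentially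
  proof
    fix K :: nat
    have s01: "s t1 < s 0" "0 < s t1" using s_less s_pos t by auto
    \<comment> \<open>From \<open>N \<ge> L\<close> on, the gap between the slopes
      \<open>s 0\<close> and \<open>s t1\<close> outweighs the error from rounding up
      \<open>p * N\<close>.\<close>
    define L where "L = s t1 / (p * (s 0 - s t1))"
    define N0 where "N0 = max 1 (max (nat \<lceil>real K / p\<rceil>) (nat \<lceil>L\<rceil>))"
    obtain N where N: "N \<ge> N0" "e \<le> F j (real (a N j)) / F i (real (a N i))"
      using freq unfolding frequently_sequentially by blast
    have "N \<ge> 1" "real K / p \<le> real N" "L \<le> real N" using N(1) unfolding N0_def by linarith+
    then have N1: "N \<ge> 1" "real K \<le> p * real N" "s t1 \<le> (p * (s 0 - s t1)) * real N"
      using pr s01 by (auto simp: L_def pos_divide_le_eq mult.commute)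
    have "s t1 * real (a N j) \<le> s t1 * (p * real N + 1)"
      using a_ge(3)[of N] s01 by (intro mult_left_mono) auto
    also have "\<dots> \<le> s 0 * p * real N" using N1(3) by (simp add: algebra_simps)
    also have "s 0 * p = r" using pr by (simp add: s_def)
    also have "r * real N \<le> real (a N i)" by (rule a_ge)
    finally have "s t1 * real (a N j) \<le> real (a N i)" .
    moreover have "0 < s t1 * real (a N j)" using s01 a_pos(2)[OF N1(1)] by simp
    ultimately have gle: "g (a N i) \<le> g (nat \<lceil>s t1 * real (a N j)\<rceil>)"
      by (intro gmono) linarith+
    have Fi: "0 < F i (real (a N i))" and Fj: "0 < F j (real (a N j))"
      using a_pos[OF N1(1)] Fpos i j by auto
    have "e \<le> e * (F i (real (a N i)) * g (a N i))"
      using g1[OF a_pos(1)[OF N1(1)]] e by simp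
    also have "\<dots> = e * F i (real (a N i)) * g (a N i)" by simp
    also have "\<dots> \<le> F j (real (a N j)) * g (a N i)"
      using N(2) Fi gpos[OF a_pos(1)[OF N1(1)]] by (intro mult_right_mono) (auto simp: field_simps)
    also have "\<dots> \<le> F j (real (a N j)) * g (nat \<lceil>s t1 * real (a N j)\<rceil>)"
      using gle Fj by simp
    finally show "\<exists>k\<ge>K. e \<le> F j (real k) * g (nat \<lceil>s t1 * real k\<rceil>)"
      using N1(2) a_ge(2)[of N] by (intro exI[of _ "a N j"]) auto
  qed
  have "\<not> (\<exists>\<^sub>F k in sequentially. F j (real k) * g (nat \<lceil>s t2 * real k\<rceil>) \<le> 1)"
  proof
    assume L: "\<exists>\<^sub>F k in sequentially. F j (real k) * g (nat \<lceil>s t2 * real k\<rceil>) \<le> 1"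
    have "\<exists>t. t1 < t \<and> t < t2 \<and>
      liminf (\<lambda>N. ereal (F j ((p + t) * real N) / F i ((r - t) * real N))) = 0 \<and>
      limsup (\<lambda>N. ereal (F j ((p + t) * real N) / F i ((r - t) * real N))) = \<infinity>"
      by (rule oscillation_between_slopes[OF q gpos decay gmono Fpos[OF j(1)] Fpos[OF i(1)]
            Fcont[OF j(1)] Fcont[OF i(1)] sandwich pr(1) _ t(2) _ e])
        (use U L t in \<open>auto simp: s_def\<close>)
    then obtain t' where t': "t1 < t'" "t' < t2"
      "liminf (\<lambda>N. ereal (F j ((p + t') * real N) / F i ((r - t') * real N))) = 0"
      "limsup (\<lambda>N. ereal (F j ((p + t') * real N) / F i ((r - t') * real N))) = \<infinity>" by blast
    have "chi(i := chi i - t', j := chi j + t') \<in> open_simplex A"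
      using t t' by (intro simplex) auto
    from osc[rule_format, OF this j(1) i(1)] show False
      using t' ij by (simp add: p_def r_def)
  qed
  then have ev: "\<forall>\<^sub>F k in sequentially. 1 < F j (real k) * g (nat \<lceil>s t2 * real k\<rceil>)"
    by (simp add: not_frequently not_le)
  have s32: "0 < s t3" "s t3 < s t2" using s_pos s_less t by auto
  \<comment> \<open>Together with \<open>F i m * g m \<le> C\<close> this constant will give the
    probability bound \<open>1 / 2\<close>.\<close>
  have C2: "0 < 1 / (2 * C)" using C by simp
  obtain K where K: "\<And>k. k \<ge> K \<Longrightarrow> summable (\<lambda>l. 1 / F j (real (l + k))) \<and>
    (\<forall>m. 1 \<le> m \<and> real m \<le> s t3 * real k + 1 \<longrightarrow> (\<Sum>l. 1 / F j (real (l + k))) \<le> 1 / (2 * C) * g m)"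
    using tail_small_at_steeper_slope[OF q gpos decay Fpos[OF j(1)] s32 C2 ev]
    unfolding eventually_sequentially by blast
  have Mj: "cond_M F j"
    unfolding cond_M_def
    by (subst summable_iff_shift[of _ K, symmetric])
      (use K[of "Suc K"] in \<open>simp add: add.commute\<close>)
  define y where "y = chi(i := chi i - t3, j := chi j + t3)"
  have y: "y \<in> D_set A F i" "y \<in> open_simplex A"
    unfolding y_def using t by (auto intro!: D simplex)
  have yij: "y i = r - t3" "y j = p + t3" using ij by (auto simp: y_def p_def r_def)
  have "\<forall>\<^sub>F N in sequentially. measure unif_seq (sMon A F i y N) \<le> 1 / 2"
    using eventually_ge_at_top[of "max 1 (nat \<lceil>real K / (p + t3)\<rceil>)"]
  proof eventually_elim
    case (elim N)
    have N: "N \<ge> 1" "real K / (p + t3) \<le> real N" using elim by linarith+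
    define m k where "m = init_config y N i" and "k = init_config y N j"
    have x1: "1 \<le> init_config y N l" if "l \<in> agents A" for l
      using y(2) that N(1) by (intro init_config_pos) (auto simp: open_simplex_def)
    have z: "0 < (p + t3) * real N" "0 < (r - t3) * real N" using pr t N by auto
    then have k: "(p + t3) * real N \<le> real k" and m: "real m \<le> (r - t3) * real N + 1"
      unfolding m_def k_def init_config_def yij by linarith+
    have "real K \<le> (p + t3) * real N" using N(2) pr t by (simp add: field_simps)
    then have "k \<ge> K" using k by linarith
    \<comment> \<open>Rounding up the count of \<open>i\<close> costs at most one, while rounding up
      the count of \<open>j\<close> only helps.\<close>
    have "(r - t3) * real N = s t3 * ((p + t3) * real N)" using pr t by (simp add: s_def)
    also have "\<dots> \<le> s t3 * real k" using k s32 by (intro mult_left_mono) auto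
    finally have "real m \<le> s t3 * real k + 1" using m by linarith
    moreover have m1: "1 \<le> m" unfolding m_def by (rule x1[OF i(1)])
    ultimately have tail: "tail_sum F j k \<le> 1 / (2 * C) * g m"
      unfolding tail_sum_def using K[OF \<open>k \<ge> K\<close>] by blast
    have "measure unif_seq (sMon A F i y N) \<le> F i (real m) * tail_sum F j k"
      unfolding m_def k_def using i(1) j(1) ij Fpos Mj x1 by (rule prob_sMon_le)
    also have "\<dots> \<le> F i (real m) * (1 / (2 * C) * g m)"
      using tail Fpos[OF i(1), of "real m"] m1 by (intro mult_left_mono) auto
    also have "\<dots> = 1 / (2 * C) * (F i (real m) * g m)" by simp
    also have "\<dots> \<le> 1 / (2 * C) * C" using gC[OF m1] C by (intro mult_left_mono) auto
    also have "\<dots> = 1 / 2" using C by simp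
    finally show ?case .
  qed
  moreover have "(\<lambda>N. measure unif_seq (sMon A F i y N)) \<longlonglongrightarrow> 1"
    using y(1) by (simp add: D_set_def)
  ultimately have "(1::real) \<le> 1 / 2"
    by (intro tendsto_upperbound) auto
  then show False by simp
qed

section \<open>From vanishing feedback ratios to total monopoly\<close>

theorem mainTheorem9:
  fixes A :: nat and F :: "nat \<Rightarrow> real \<Rightarrow> real" and i :: nat and chi :: "nat \<Rightarrow> real"
  assumes "A \<ge> 2"
    and "admissible_feedback A F"
    and "\<exists>k\<in>agents A. cond_M F k"
    and "\<forall>k\<in>agents A. cond_M F k \<longrightarrow> type_P F k \<or> type_E F k"
    and "\<exists>k\<in>agents A. type_E F k"
    and "\<forall>x\<in>open_simplex A. \<forall>k\<in>agents A. \<forall>l\<in>agents A.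
           \<not> (liminf (\<lambda>N. ereal (F k (x k * real N) / F l (x l * real N))) = 0 \<and>
              limsup (\<lambda>N. ereal (F k (x k * real N) / F l (x l * real N))) = \<infinity>)"
    and "i \<in> agents A"
    and "type_E F i"
    and "chi \<in> (top_of_set (open_simplex A)) interior_of (D_set A F i)"
  shows "(\<lambda>N. measure unif_seq (tMon A F i chi N)) \<longlonglongrightarrow> 1"
proof -
  let ?a = "init_config chi"
  have Fpos: "0 < F l x" if "l \<in> agents A" "0 < x" for l x
    using assms(2) that by (auto simp: admissible_feedback_def)
  have M: "cond_M F i" using assms(8) by (simp add: type_E_def)
  obtain C q where C: "0 < C" and gC: "\<And>k. k \<ge> 1 \<Longrightarrow> F i (real k) * tail_sum F i k \<le> C"
    using type_E_decay[OF assms(8)] Fpos assms(7) by metis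
  have "chi \<in> open_simplex A"
    using assms(9) interior_of_subset by (fastforce simp: D_set_def)
  then have chi: "0 < chi l" if "l \<in> agents A" for l
    using that by (simp add: open_simplex_def)
  define ratio where "ratio = (\<lambda>N. \<Sum>j\<in>agents A - {i}. F j (real (?a N j)) / F i (real (?a N i)))"
  have "ratio \<longlonglongrightarrow> (\<Sum>j\<in>agents A - {i}. 0)"
    unfolding ratio_def by (intro tendsto_sum feedback_ratio_tendsto_0[OF assms(2,6,7,8,9)]) auto
  then have "(\<lambda>N. 1 - ratio N * C) \<longlonglongrightarrow> 1 - 0 * C"
    by (intro tendsto_intros) simp
  then have lim: "(\<lambda>N. 1 - ratio N * C) \<longlonglongrightarrow> 1" by simp
  have "\<forall>\<^sub>F N in sequentially. 1 - ratio N * C \<le> measure unif_seq (tMon A F i chi N)"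
    using eventually_ge_at_top[of 1]
  proof eventually_elim
    case (elim N)
    have x1: "1 \<le> ?a N l" if "l \<in> agents A" for l
      using chi[OF that] elim by (rule init_config_pos)
    define S where "S = (\<Sum>j\<in>agents A - {i}. F j (real (?a N j)))"
    have S: "0 \<le> S"
      unfolding S_def using Fpos x1 by (intro sum_nonneg less_imp_le) (auto simp: Suc_le_eq)
    have Fi: "0 < F i (real (?a N i))" using Fpos x1 assms(7) by (simp add: Suc_le_eq)
    \<comment> \<open>Type E replaces the tail sum by \<open>C / F i\<close>, so the failure
      probability is at most \<open>C\<close> times the sum of the ratios.\<close>
    have "S * tail_sum F i (?a N i) \<le> S * (C / F i (real (?a N i)))"
      using gC[OF x1[OF assms(7)]] Fi S by (intro mult_left_mono) (auto simp: field_simps)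
    also have "\<dots> = ratio N * C"
      by (simp add: ratio_def S_def sum_divide_distrib[symmetric])
    finally have "1 - ratio N * C \<le> 1 - S * tail_sum F i (?a N i)" by simp
    also have "\<dots> \<le> measure unif_seq (tMon A F i chi N)"
      unfolding S_def using assms(7) Fpos M x1 by (rule prob_tMon_ge)
    finally show ?case .
  qed
  moreover have "\<forall>\<^sub>F N in sequentially. measure unif_seq (tMon A F i chi N) \<le> 1"
    by (simp add: useq.prob_le_1)
  ultimately show ?thesis
    using lim tendsto_const by (rule tendsto_sandwich)
qed

end
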